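(* (a) The Dirichlet problems $$-\Delta v=(\lambda_1-\varepsilon)v-L|\nabla v|-h\ \text{ in }\Omega,\quad v=0\text{ on }\partial\Omega \tag{D0}$$ and $$-\Delta v=(\lambda_1-\varepsilon)v+L|\nabla v|+h\ \text{ in }\Omega,\quad v=0\text{ on }\partial\Omega \tag{D1}$$ each have a unique weak solution, denoted $v_\downarrow$ and $v_\uparrow$ respectively, and $v_\downarrow\le0\le v_\uparrow$ almost everywhere. (b) Assume moreover that $f$ satisfies the coerciveness condition (C). Let $\mu\ge\max\{0,\varepsilon-\lambda_1\}$, $0<t\le1$, let $\omega\subseteq\Omega$ be open, and let $v_0\le0\le v_1$ be measurable functions on $\Omega$. Then every weak solution $u$ of problem $(P_{\mu,t,\omega,v_0,v_1})$ satisfies $v_\downarrow\le u\le v_\uparrow$ almost everywhere in $\Omega$.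
   Context: Let $\Omega\subseteq\mathbb R^d$ be an arbitrary open set. $\lambda_1=\lambda_1(\Omega)\ge0$ denotes the largest real number such that $\lambda_1\|u\|^2_{L_2(\Omega)}\le\|\nabla u\|^2_{L_2(\Omega)}$ for all $u\in H^1_0(\Omega)$. Fix $\varepsilon>0$, $q\ge2$ with $q\ne d/2$, and $0\le h\in L_2(\Omega)\cap L_q(\Omega)$. Define $L_{\max}=\varepsilon/\sqrt{\lambda_1}$ if $\varepsilon\le2\lambda_1$ and $L_{\max}=2\sqrt{\varepsilon-\lambda_1}$ if $\varepsilon\ge2\lambda_1$. Let $0\le L<L_{\max}$. A weak solution of (D1) is a function $v\in H^1_0(\Omega)$ with $\int_\Omega\nabla v\cdot\nabla\varphi\,dx=\int_\Omega\big((\lambda_1-\varepsilon)v+L|\nabla v|+h\big)\varphi\,dx$ for all $\varphi\in C_c^\infty(\Omega)$. Weak solutions of (D0) are defined analogously. $f:\Omega\times\mathbb R\times\mathbb R^d\to\mathbb R$ is a Carathéodory function: it is measurable in $x$ for fixed $(s,\xi)$, and continuous in $(s,\xi)$ for almost every $x$. Coerciveness condition (C): $f(x,s,\xi)s\le(\lambda_1-\varepsilon)s^2+L|\xi||s|+h(x)|s|$ for all $x\in\Omega$, $s\in\mathbb R$ and $\xi\in\mathbb R^d$. Problem $(P_{\mu,t,\omega,v_0,v_1})$: let $\mu\ge0$, $0<t\le1$, let $\omega\subseteq\Omega$ be open, and let $v_0\le0\le v_1$ be measurable functions on $\Omega$. Set $$\sigma(x,s)=\max\{v_0(x),\min\{s,v_1(x)\}\},\qquad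 b_\sigma(x,s,\xi)=f(x,\sigma(x,s),\xi)+\mu\sigma(x,s).$$ A weak solution of $-\Delta u+\mu u=t\,b_\sigma(x,u,\nabla u)\chi_\omega$ in $\Omega$, $u=0$ on $\partial\Omega$, is a function $u\in H^1_0(\Omega)$ with $b_\sigma(\cdot,u,\nabla u)\chi_\omega\in L_2(\Omega)$ and $$\int_\Omega\nabla u\cdot\nabla\varphi\,dx+\mu\int_\Omega u\varphi\,dx=t\int_\omega b_\sigma(x,u,\nabla u)\varphi\,dx$$ for all $\varphi\in C_c^\infty(\Omega)$. *)

theory Defs
  imports "HOL-Analysis.Analysis"
begin

coinductive smooth_fun :: "('a::euclidean_space \<Rightarrow> real) \<Rightarrow> bool" where
  "\<lbrakk> \<forall>x. f differentiable (at x);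
     \<forall>v. smooth_fun (\<lambda>x. frechet_derivative f (at x) v) \<rbrakk> \<Longrightarrow> smooth_fun f"

definition fsupport :: "('a::euclidean_space \<Rightarrow> real) \<Rightarrow> 'a set" where
  "fsupport \<phi> = closure {x. \<phi> x \<noteq> 0}"

definition test_fun :: "'a::euclidean_space set \<Rightarrow> ('a \<Rightarrow> real) \<Rightarrow> bool" where
  "test_fun \<Omega> \<phi> \<longleftrightarrow> smooth_fun \<phi> \<and> compact (fsupport \<phi>) \<and> fsupport \<phi> \<subseteq> \<Omega>"

definition grad :: "('a::euclidean_space \<Rightarrow> real) \<Rightarrow> 'a \<Rightarrow> 'a" where
  "grad \<phi> x = (\<Sum>b\<in>Basis. frechet_derivative \<phi> (at x) b *\<^sub>R b)"

definition L2 :: "'a::euclidean_space set \<Rightarrow> ('a \<Rightarrow> real) \<Rightarrow> bool" where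
  "L2 \<Omega> u \<longleftrightarrow> set_borel_measurable lebesgue \<Omega> u \<and>
                 set_integrable lebesgue \<Omega> (\<lambda>x. (u x)\<^sup>2)"

definition L2v :: "'a::euclidean_space set \<Rightarrow> ('a \<Rightarrow> 'a) \<Rightarrow> bool" where
  "L2v \<Omega> g \<longleftrightarrow> set_borel_measurable lebesgue \<Omega> g \<and>
                 set_integrable lebesgue \<Omega> (\<lambda>x. (norm (g x))\<^sup>2)"

definition Lq :: "real \<Rightarrow> 'a::euclidean_space set \<Rightarrow> ('a \<Rightarrow> real) \<Rightarrow> bool" where
  "Lq q \<Omega> u \<longleftrightarrow> set_borel_measurable lebesgue \<Omega> u \<and>
                 set_integrable lebesgue \<Omega> (\<lambda>x. \<bar>u x\<bar> powr q)"

text \<open>H10 Omega u g: u belongs to H^1_0(Omega), the closure of C_c^infinity(Omega)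
in the H^1(Omega) norm, and g is its (weak) gradient.\<close>
definition H10 :: "'a::euclidean_space set \<Rightarrow> ('a \<Rightarrow> real) \<Rightarrow> ('a \<Rightarrow> 'a) \<Rightarrow> bool" where
  "H10 \<Omega> u g \<longleftrightarrow> L2 \<Omega> u \<and> L2v \<Omega> g \<and>
     (\<exists>\<phi>::nat \<Rightarrow> 'a \<Rightarrow> real. (\<forall>n. test_fun \<Omega> (\<phi> n)) \<and>
        (\<lambda>n. LINT x:\<Omega>|lebesgue. (\<phi> n x - u x)\<^sup>2) \<longlonglongrightarrow> 0 \<and>
        (\<lambda>n. LINT x:\<Omega>|lebesgue. (norm (grad (\<phi> n) x - g x))\<^sup>2) \<longlonglongrightarrow> 0)"

text \<open>First Dirichlet eigenvalue: the largest lambda with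
 lambda ||u||^2 <= ||grad u||^2 on H^1_0.\<close>
definition lambda1 :: "'a::euclidean_space set \<Rightarrow> real" where
  "lambda1 \<Omega> = Sup {c. \<forall>u g. H10 \<Omega> u g \<longrightarrow>
       c * (LINT x:\<Omega>|lebesgue. (u x)\<^sup>2) \<le> (LINT x:\<Omega>|lebesgue. (norm (g x))\<^sup>2)}"

definition Lmax :: "real \<Rightarrow> real \<Rightarrow> real" where
  "Lmax \<epsilon> lam = (if \<epsilon> \<le> 2 * lam then \<epsilon> / sqrt lam else 2 * sqrt (\<epsilon> - lam))"

definition weak_sol_D1 :: "'a::euclidean_space set \<Rightarrow> real \<Rightarrow> real \<Rightarrow> ('a \<Rightarrow> real) \<Rightarrow> ('a \<Rightarrow> real) \<Rightarrow> bool" where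
  "weak_sol_D1 \<Omega> \<epsilon> L h v \<longleftrightarrow> (\<exists>g. H10 \<Omega> v g \<and>
     (\<forall>\<phi>. test_fun \<Omega> \<phi> \<longrightarrow>
        (LINT x:\<Omega>|lebesgue. g x \<bullet> grad \<phi> x) =
        (LINT x:\<Omega>|lebesgue. ((lambda1 \<Omega> - \<epsilon>) * v x + L * norm (g x) + h x) * \<phi> x)))"

definition weak_sol_D0 :: "'a::euclidean_space set \<Rightarrow> real \<Rightarrow> real \<Rightarrow> ('a \<Rightarrow> real) \<Rightarrow> ('a \<Rightarrow> real) \<Rightarrow> bool" where
  "weak_sol_D0 \<Omega> \<epsilon> L h v \<longleftrightarrow> (\<exists>g. H10 \<Omega> v g \<and>
     (\<forall>\<phi>. test_fun \<Omega> \<phi> \<longrightarrow>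
        (LINT x:\<Omega>|lebesgue. g x \<bullet> grad \<phi> x) =
        (LINT x:\<Omega>|lebesgue. ((lambda1 \<Omega> - \<epsilon>) * v x - L * norm (g x) - h x) * \<phi> x)))"

definition caratheodory :: "'a::euclidean_space set \<Rightarrow> ('a \<Rightarrow> real \<Rightarrow> 'a \<Rightarrow> real) \<Rightarrow> bool" where
  "caratheodory \<Omega> f \<longleftrightarrow>
     (\<forall>s \<xi>. set_borel_measurable lebesgue \<Omega> (\<lambda>x. f x s \<xi>)) \<and>
     (AE x in lebesgue. x \<in> \<Omega> \<longrightarrow> continuous_on UNIV (\<lambda>(s, \<xi>). f x s \<xi>))"

definition coercive :: "'a::euclidean_space set \<Rightarrow> real \<Rightarrow> real \<Rightarrow> ('a \<Rightarrow> real) \<Rightarrow> ('a \<Rightarrow> real \<Rightarrow> 'a \<Rightarrow> real) \<Rightarrow> bool" where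
  "coercive \<Omega> \<epsilon> L h f \<longleftrightarrow> (\<forall>x\<in>\<Omega>. \<forall>s \<xi>.
     f x s \<xi> * s \<le> (lambda1 \<Omega> - \<epsilon>) * s\<^sup>2 + L * norm \<xi> * \<bar>s\<bar> + h x * \<bar>s\<bar>)"

definition sigma_trunc :: "('a \<Rightarrow> real) \<Rightarrow> ('a \<Rightarrow> real) \<Rightarrow> 'a \<Rightarrow> real \<Rightarrow> real" where
  "sigma_trunc v0 v1 x s = max (v0 x) (min s (v1 x))"

definition b_sigma :: "('a \<Rightarrow> real \<Rightarrow> 'a \<Rightarrow> real) \<Rightarrow> real \<Rightarrow> ('a \<Rightarrow> real) \<Rightarrow> ('a \<Rightarrow> real)
      \<Rightarrow> 'a \<Rightarrow> real \<Rightarrow> 'a \<Rightarrow> real" where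
  "b_sigma f \<mu> v0 v1 x s \<xi> = f x (sigma_trunc v0 v1 x s) \<xi> + \<mu> * sigma_trunc v0 v1 x s"

definition weak_sol_P :: "'a::euclidean_space set \<Rightarrow> ('a \<Rightarrow> real \<Rightarrow> 'a \<Rightarrow> real) \<Rightarrow> real \<Rightarrow> real
     \<Rightarrow> 'a set \<Rightarrow> ('a \<Rightarrow> real) \<Rightarrow> ('a \<Rightarrow> real) \<Rightarrow> ('a \<Rightarrow> real) \<Rightarrow> bool" where
  "weak_sol_P \<Omega> f \<mu> t \<omega> v0 v1 u \<longleftrightarrow> (\<exists>g. H10 \<Omega> u g \<and>
     L2 \<Omega> (\<lambda>x. b_sigma f \<mu> v0 v1 x (u x) (g x) * indicator \<omega> x) \<and>
     (\<forall>\<phi>. test_fun \<Omega> \<phi> \<longrightarrow>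
        (LINT x:\<Omega>|lebesgue. g x \<bullet> grad \<phi> x) + \<mu> * (LINT x:\<Omega>|lebesgue. u x * \<phi> x) =
        t * (LINT x:\<omega>|lebesgue. b_sigma f \<mu> v0 v1 x (u x) (g x) * \<phi> x)))"

end

theory Submission
  imports Defs
begin

text \<open>The space \<open>H\<^sup>1\<^sub>0(\<Omega>)\<close> is the closure of the pairs \<open>(\<phi>, \<nabla>\<phi>)\<close> in the Hilbert space
  \<open>L\<^sub>2(\<real>\<^sup>d; \<real> \<times> \<real>\<^sup>d)\<close>, and (D1) says that \<open>((\<epsilon> - \<lambda>\<^sub>1) v - L \<bar>\<nabla>v\<bar> - h, \<nabla>v)\<close> is orthogonal to it.
  By Cauchy-Schwarz and the Poincare inequality, the condition \<open>L < L\<^sub>m\<^sub>a\<^sub>x\<close> is exactly what makes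
  \<open>\<parallel>\<nabla>z\<parallel>\<^sup>2 - L \<parallel>\<nabla>z\<parallel> \<parallel>z\<parallel> + (\<epsilon> - \<lambda>\<^sub>1) \<parallel>z\<parallel>\<^sup>2\<close> coercive, so the nonlinear operator is Lipschitz and strongly
  monotone and the equation is solved by a contraction argument (Zarantonello). Testing with
  \<open>z = (u - v)\<^sup>+\<close> turns the same coercivity into a comparison principle for subsolutions \<open>u\<close> of (D1): it
  yields uniqueness, \<open>v \<ge> 0\<close> (with \<open>u = 0\<close>), and the bound in (b), because condition (C) makes solutions of
  (P) subsolutions where they are positive. (D0) is (D1) for \<open>-v\<close>.\<close>

section \<open>Strongly monotone equations in Hilbert spaces\<close>

text \<open>Let X and Y be the norms of the gradient and of the function, and r = X/Y. The form is
  Y^2 (r^2 - L r + epsilon - lambda_1), and Poincare says r >= sqrt lambda_1. The parabola has its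
  vertex at r = L/2. If epsilon <= 2 lambda_1, the bound on L keeps the vertex at or to the left of
  sqrt lambda_1, and the endpoint value epsilon - L sqrt lambda_1 must be positive; otherwise
  positivity of the vertex value epsilon - lambda_1 - L^2/4 suffices. These are the two branches of
  L_max. Either value controls only Y^2; part of it is then spent on controlling X^2 as well,
  because monotonicity is needed in the full norm of the pair. The obstacle to comparison is the
  test function (u - v)^+: H^1_0 is given only as a closure of smooth functions, and positive parts
  of smooth functions are not smooth. It is reached through a smooth regularisation of the absolute
  value, with two limits: first the test functions tend to the given element, then the
  regularisation parameter tends to 0.\<close>

lemma orthogonal_projection_exists:
  fixes S :: "'h::{real_inner,complete_space} set"
  assumes "subspace S" "closed S"
  shows "\<exists>p\<in>S. \<forall>s\<in>S. (x - p) \<bullet> s = 0"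
proof -
  define d where "d = infdist x S"
  have ne: "S \<noteq> {}" using assms(1) subspace_0 by blast
  have d0: "0 \<le> d" by (simp add: d_def infdist_nonneg)
  have d_le: "d \<le> dist x s" if "s \<in> S" for s
    using that by (simp add: d_def infdist_le)
  have "\<exists>s\<in>S. dist x s < d + inverse (Suc n)" for n
  proof (rule ccontr)
    assume "\<not> ?thesis"
    then have "d + inverse (Suc n) \<le> dist x s" if "s \<in> S" for s
      using that by force
    then have "d + inverse (Suc n) \<le> d"
      unfolding d_def infdist_notempty[OF ne] using ne by (intro cINF_greatest) auto
    then show False by simp
  qed
  then obtain s where s: "\<And>n. s n \<in> S" "\<And>n. dist x (s n) < d + inverse (Suc n)"
    by metis
  \<comment> \<open>Parallelogram law for x - s m and x - s n. The midpoint of s m and s n lies in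
    S, so half the norm of the sum is at least d; this is what makes the minimising sequence
    Cauchy.\<close>
  have para: "(norm (s m - s n))\<^sup>2 \<le> 2 * (dist x (s m))\<^sup>2 + 2 * (dist x (s n))\<^sup>2 - 4 * d\<^sup>2" for m n
  proof -
    let ?a = "x - s m" and ?b = "x - s n"
    have "(1/2) *\<^sub>R (s m + s n) \<in> S"
      using assms(1) s(1) by (simp add: subspace_add subspace_scale)
    then have "d \<le> norm ((1/2) *\<^sub>R (?a + ?b))"
      using d_le[of "(1/2) *\<^sub>R (s m + s n)"]
      by (simp add: dist_norm algebra_simps flip: scaleR_add_left)
    then have "4 * d\<^sup>2 \<le> (norm (?a + ?b))\<^sup>2"
      using d0 power_mono[of d "norm (?a + ?b) / 2" 2] by (simp add: power_divide)
    moreover have "(norm (s m - s n))\<^sup>2 = 2 * (norm ?a)\<^sup>2 + 2 * (norm ?b)\<^sup>2 - (norm (?a + ?b))\<^sup>2"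
      by (simp add: power2_norm_eq_inner algebra_simps inner_commute)
    ultimately show ?thesis by (simp add: dist_norm)
  qed
  have "(\<lambda>n. dist x (s n)) \<longlonglongrightarrow> d"
  proof (rule tendsto_sandwich)
    show "(\<lambda>n. d) \<longlonglongrightarrow> d" by simp
    show "(\<lambda>n. d + inverse (Suc n)) \<longlonglongrightarrow> d"
      using tendsto_add[OF tendsto_const LIMSEQ_inverse_real_of_nat, of d] by simp
  qed (use d_le s in \<open>auto intro!: always_eventually less_imp_le\<close>)
  then have lim2: "(\<lambda>n. (dist x (s n))\<^sup>2 - d\<^sup>2) \<longlonglongrightarrow> 0"
    using tendsto_diff[OF tendsto_power tendsto_const, of _ d sequentially 2 "d\<^sup>2"] by simp
  have "Cauchy s"
  proof (rule CauchyI)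
    fix e :: real assume "0 < e"
    then have "\<forall>\<^sub>F n in sequentially. (dist x (s n))\<^sup>2 - d\<^sup>2 < e\<^sup>2 / 4"
      using lim2 by (intro order_tendstoD) auto
    then obtain N where N: "\<And>n. n \<ge> N \<Longrightarrow> (dist x (s n))\<^sup>2 - d\<^sup>2 < e\<^sup>2 / 4"
      by (auto simp: eventually_sequentially)
    have "norm (s m - s n) < e" if "m \<ge> N" "n \<ge> N" for m n
    proof -
      have "(norm (s m - s n))\<^sup>2 < e\<^sup>2"
        using para[of m n] N[OF that(1)] N[OF that(2)] by linarith
      then show ?thesis using \<open>0 < e\<close> by (simp add: power2_less_imp_less)
    qed
    then show "\<exists>M. \<forall>m\<ge>M. \<forall>n\<ge>M. norm (s m - s n) < e" by blast
  qed
  then obtain p where p: "s \<longlonglongrightarrow> p" using Cauchy_convergent convergent_def by blast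
  have pS: "p \<in> S" using assms(2) p s(1) closed_sequential_limits by blast
  have "(\<lambda>n. dist x (s n)) \<longlonglongrightarrow> dist x p" using p by (intro tendsto_intros)
  then have dp: "dist x p = d"
    using \<open>(\<lambda>n. dist x (s n)) \<longlonglongrightarrow> d\<close> LIMSEQ_unique by blast
  have "(x - p) \<bullet> v = 0" if v: "v \<in> S" for v
  proof -
    \<comment> \<open>Minimality of p against the competitors p + t v. With c =
      \<open>(x - p) \<bullet> v\<close>, the value t = \<open>c / (v \<bullet> v)\<close> used
      below minimises the resulting quadratic in t and leaves c^2 <= 0.\<close>
    have "2 * t * ((x - p) \<bullet> v) \<le> t\<^sup>2 * (v \<bullet> v)" for t
    proof -
      have "d \<le> dist x (p + t *\<^sub>R v)"
        using d_le assms(1) pS v by (simp add: subspace_add subspace_scale)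
      then have "d\<^sup>2 \<le> (norm ((x - p) - t *\<^sub>R v))\<^sup>2"
        using d0 by (intro power_mono) (simp_all add: dist_norm algebra_simps)
      also have "\<dots> = (norm (x - p))\<^sup>2 - 2 * t * ((x - p) \<bullet> v) + t\<^sup>2 * (v \<bullet> v)"
        unfolding power2_norm_eq_inner
        by (simp add: inner_diff inner_commute algebra_simps power2_eq_square)
      finally show ?thesis using dp by (simp add: dist_norm)
    qed
    note ineq = this
    show ?thesis
    proof (cases "v = 0")
      case False
      then have pos: "v \<bullet> v > 0" by simp
      define c where "c = (x - p) \<bullet> v"
      have "2 * (c / (v \<bullet> v)) * c \<le> (c / (v \<bullet> v))\<^sup>2 * (v \<bullet> v)"
        using ineq[of "c / (v \<bullet> v)"] by (simp add: c_def)
      then have "c\<^sup>2 \<le> 0" using pos by (simp add: field_simps power2_eq_square)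
      then show ?thesis by (simp add: c_def)
    qed simp
  qed
  then show ?thesis using pS by blast
qed

text \<open>Zarantonello: for small \<open>\<tau>\<close> the map \<open>w \<mapsto> w - \<tau> P (N w)\<close>, with \<open>P\<close> the orthogonal
  projection onto \<open>S\<close>, is a contraction of \<open>S\<close>.\<close>

lemma strongly_monotone_equation_solvable:
  fixes S :: "'h::{real_inner,complete_space} set" and N :: "'h \<Rightarrow> 'h"
  assumes S: "subspace S" "closed S" and "0 < c"
    and mono: "\<And>v w. v \<in> S \<Longrightarrow> w \<in> S \<Longrightarrow> c * (norm (v - w))\<^sup>2 \<le> (N v - N w) \<bullet> (v - w)"
    and lip: "\<And>v w. v \<in> S \<Longrightarrow> w \<in> S \<Longrightarrow> norm (N v - N w) \<le> M * norm (v - w)"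
  shows "\<exists>w\<in>S. \<forall>s\<in>S. N w \<bullet> s = 0"
proof -
  obtain P where P: "\<And>x. P x \<in> S" "\<And>x s. s \<in> S \<Longrightarrow> (x - P x) \<bullet> s = 0"
    using orthogonal_projection_exists[OF S] by metis
  \<comment> \<open>The maximum with c forces 0 < c <= K, so that 1 - c^2/K^2 lies in [0, 1) and is
    the square of a contraction factor. The step size \<tau> = c/K^2 minimises 1 - 2 \<tau> c +
    \<tau>^2 K^2.\<close>
  define K where "K = max \<bar>M\<bar> c"
  have K: "0 < K" "c \<le> K" "M \<le> K" using \<open>0 < c\<close> by (auto simp: K_def)
  define \<tau> where "\<tau> = c / K\<^sup>2"
  have "0 < \<tau>" using K \<open>0 < c\<close> by (simp add: \<tau>_def)
  define T where "T w = w - \<tau> *\<^sub>R P (N w)" for w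
  define q where "q = sqrt (1 - c\<^sup>2 / K\<^sup>2)"
  have "c\<^sup>2 / K\<^sup>2 \<le> 1" using K \<open>0 < c\<close> by (simp add: power_mono)
  then have q: "0 \<le> q" "q < 1" "q\<^sup>2 = 1 - c\<^sup>2 / K\<^sup>2"
    using K \<open>0 < c\<close> by (auto simp: q_def)
  have contr: "dist (T v) (T w) \<le> q * dist v w" if "v \<in> S" "w \<in> S" for v w
  proof -
    let ?z = "v - w" and ?n = "N v - N w" and ?p = "P (N v) - P (N w)"
    have zS: "?z \<in> S" and pS: "?p \<in> S" using that P(1) S(1) by (auto simp: subspace_diff)
    \<comment> \<open>P comes from a choice and has not been shown to be linear. Orthogonality of
      the two residuals still lets \<open>P (N v) - P (N w)\<close> represent
      \<open>N v - N w\<close> on S; testing with this difference itself and Cauchy-Schwarz then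
      show that P does not expand distances.\<close>
    have nz: "?n \<bullet> s = ?p \<bullet> s" if "s \<in> S" for s
      using P(2)[OF that, of "N v"] P(2)[OF that, of "N w"] by (simp add: inner_diff_left)
    have "(norm ?p)\<^sup>2 = ?n \<bullet> ?p" using nz[OF pS] by (simp add: power2_norm_eq_inner)
    also have "\<dots> \<le> norm ?n * norm ?p" by (rule norm_cauchy_schwarz)
    finally have "norm ?p \<le> norm ?n"
      by (cases "norm ?p = 0") (auto simp: power2_eq_square)
    also have "\<dots> \<le> K * norm ?z"
      using lip[OF that] K(3) by (meson mult_right_mono norm_ge_zero order_trans)
    finally have "(norm ?p)\<^sup>2 \<le> K\<^sup>2 * (norm ?z)\<^sup>2"
      by (metis norm_ge_zero power_mono power_mult_distrib)
    then have pb: "\<tau>\<^sup>2 * (norm ?p)\<^sup>2 \<le> \<tau>\<^sup>2 * (K\<^sup>2 * (norm ?z)\<^sup>2)"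
      by (intro mult_left_mono) auto
    have "c * (norm ?z)\<^sup>2 \<le> ?p \<bullet> ?z" using mono[OF that] nz[OF zS] by simp
    then have mb: "2 * \<tau> * (c * (norm ?z)\<^sup>2) \<le> 2 * \<tau> * (?p \<bullet> ?z)"
      using \<open>0 < \<tau>\<close> by (intro mult_left_mono) auto
    have expand: "(norm (z - \<tau> *\<^sub>R p))\<^sup>2 = (norm z)\<^sup>2 - 2 * \<tau> * (p \<bullet> z) + \<tau>\<^sup>2 * (norm p)\<^sup>2"
      for z p :: 'h
      unfolding power2_norm_eq_inner by (simp add: inner_diff inner_commute power2_eq_square algebra_simps)
    have "T v - T w = ?z - \<tau> *\<^sub>R ?p" by (simp add: T_def algebra_simps)
    then have "(norm (T v - T w))\<^sup>2 = (norm ?z)\<^sup>2 - 2 * \<tau> * (?p \<bullet> ?z) + \<tau>\<^sup>2 * (norm ?p)\<^sup>2"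
      by (simp only: expand)
    also have "\<dots> \<le> (norm ?z)\<^sup>2 - 2 * \<tau> * (c * (norm ?z)\<^sup>2) + \<tau>\<^sup>2 * (K\<^sup>2 * (norm ?z)\<^sup>2)"
      using pb mb by linarith
    also have "\<dots> = (q * norm ?z)\<^sup>2"
    proof -
      have "y - 2 * \<tau> * (c * y) + \<tau>\<^sup>2 * (K\<^sup>2 * y) = (1 - c\<^sup>2 / K\<^sup>2) * y" for y
        using K(1) by (simp add: \<tau>_def field_simps power2_eq_square)
      then show ?thesis by (simp only: power_mult_distrib q(3))
    qed
    finally show ?thesis
      unfolding dist_norm by (rule power2_le_imp_le) (simp add: q(1))
  qed
  have "\<exists>!w\<in>S. T w = w"
  proof (rule Banach_fix[where c = q])
    show "complete S" using S(2) by (simp add: complete_eq_closed)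
    show "S \<noteq> {}" using S(1) subspace_0 by blast
    show "T ` S \<subseteq> S" using S(1) P(1) by (auto simp: T_def subspace_diff subspace_scale)
  qed (use q contr in auto)
  then obtain w where w: "w \<in> S" "T w = w" by blast
  then have "P (N w) = 0" using \<open>0 < \<tau>\<close> by (simp add: T_def)
  then have "N w \<bullet> s = 0" if "s \<in> S" for s using P(2)[OF that, of "N w"] by simp
  then show ?thesis using w by blast
qed

section \<open>The Hilbert space of square-integrable functions\<close>

definition sq_integrable :: "('a::euclidean_space \<Rightarrow> 'b::euclidean_space) \<Rightarrow> bool" where
  "sq_integrable f \<longleftrightarrow> f \<in> borel_measurable lebesgue \<and> integrable lebesgue (\<lambda>x. (norm (f x))\<^sup>2)"

lemma sq_integrable_measurable [measurable_dest]:
  "sq_integrable f \<Longrightarrow> f \<in> borel_measurable lebesgue"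
  by (simp add: sq_integrable_def)

lemma sq_integrable_norm_sq: "sq_integrable f \<Longrightarrow> integrable lebesgue (\<lambda>x. (norm (f x))\<^sup>2)"
  by (simp add: sq_integrable_def)

lemma sq_integrable_bound:
  fixes f :: "'a::euclidean_space \<Rightarrow> 'b::euclidean_space" and g :: "'a \<Rightarrow> 'c::euclidean_space"
  assumes "sq_integrable g" "f \<in> borel_measurable lebesgue" "AE x in lebesgue. norm (f x) \<le> norm (g x)"
  shows "sq_integrable f"
proof -
  have "integrable lebesgue (\<lambda>x. (norm (f x))\<^sup>2)"
  proof (rule Bochner_Integration.integrable_bound[OF sq_integrable_norm_sq[OF assms(1)]])
    show "AE x in lebesgue. norm ((norm (f x))\<^sup>2) \<le> norm ((norm (g x))\<^sup>2)"
      using assms(3) by eventually_elim (simp add: power_mono)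
  qed (use assms(2) in measurable)
  then show ?thesis using assms(2) by (simp add: sq_integrable_def)
qed

lemma sq_integrable_zero: "sq_integrable (\<lambda>x. 0)"
  by (simp add: sq_integrable_def)

lemma sq_integrable_add:
  assumes "sq_integrable f" "sq_integrable g"
  shows "sq_integrable (\<lambda>x. f x + g x)"
proof -
  note [measurable] = assms[THEN sq_integrable_measurable]
  have "integrable lebesgue (\<lambda>x. (norm (f x + g x))\<^sup>2)"
  proof (rule Bochner_Integration.integrable_bound)
    show "integrable lebesgue (\<lambda>x. 2 * (norm (f x))\<^sup>2 + 2 * (norm (g x))\<^sup>2)"
      using assms by (simp add: sq_integrable_norm_sq)
    have "(norm (f x + g x))\<^sup>2 \<le> 2 * (norm (f x))\<^sup>2 + 2 * (norm (g x))\<^sup>2" for x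
    proof -
      have "(norm (f x + g x))\<^sup>2 \<le> (norm (f x) + norm (g x))\<^sup>2"
        by (simp add: norm_triangle_ineq power_mono)
      then show ?thesis using sum_squares_bound[of "norm (f x)" "norm (g x)"] by (simp add: power2_sum)
    qed
    then show "AE x in lebesgue. norm ((norm (f x + g x))\<^sup>2) \<le> norm (2 * (norm (f x))\<^sup>2 + 2 * (norm (g x))\<^sup>2)"
      by simp
  qed measurable
  then show ?thesis by (simp add: sq_integrable_def)
qed

lemma sq_integrable_scaleR:
  assumes "sq_integrable f" shows "sq_integrable (\<lambda>x. c *\<^sub>R f x)"
  using assms by (auto simp: sq_integrable_def power_mult_distrib intro: borel_measurable_scaleR)

lemma sq_integrable_uminus: "sq_integrable f \<Longrightarrow> sq_integrable (\<lambda>x. - f x)"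
  by (simp add: sq_integrable_def)

lemma sq_integrable_diff:
  assumes "sq_integrable f" "sq_integrable g"
  shows "sq_integrable (\<lambda>x. f x - g x)"
  using sq_integrable_add[OF assms(1) sq_integrable_uminus[OF assms(2)]] by simp

lemma integrable_inner_sq_integrable:
  assumes "sq_integrable f" "sq_integrable g"
  shows "integrable lebesgue (\<lambda>x. f x \<bullet> g x)"
proof (rule Bochner_Integration.integrable_bound)
  note [measurable] = assms[THEN sq_integrable_measurable]
  show "integrable lebesgue (\<lambda>x. (norm (f x))\<^sup>2 + (norm (g x))\<^sup>2)"
    using assms by (simp add: sq_integrable_norm_sq)
  show "(\<lambda>x. f x \<bullet> g x) \<in> borel_measurable lebesgue" by measurable
  have "\<bar>f x \<bullet> g x\<bar> \<le> (norm (f x))\<^sup>2 + (norm (g x))\<^sup>2" for x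
  proof -
    have "\<bar>f x \<bullet> g x\<bar> \<le> norm (f x) * norm (g x)" by (rule Cauchy_Schwarz_ineq2)
    moreover have "0 \<le> norm (f x) * norm (g x)" by simp
    ultimately show ?thesis using sum_squares_bound[of "norm (f x)" "norm (g x)"] by linarith
  qed
  then show "AE x in lebesgue. norm (f x \<bullet> g x) \<le> norm ((norm (f x))\<^sup>2 + (norm (g x))\<^sup>2)" by simp
qed

\<comment> \<open>\<open>strongly_monotone_equation_solvable\<close> works over a type of classes
  \<open>real_inner\<close> and \<open>complete_space\<close>, where norm zero must mean zero; hence
  functions that agree almost everywhere are identified. The relation is partial because only
  square-integrable functions have a class.\<close>
quotient_type (overloaded) ('a, 'b) l2 = "'a::euclidean_space \<Rightarrow> 'b::euclidean_space" / partial: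
  "\<lambda>f g. sq_integrable f \<and> sq_integrable g \<and> (AE x in lebesgue. f x = g x)"
proof (rule part_equivpI)
  show "\<exists>f::'a \<Rightarrow> 'b. sq_integrable f \<and> sq_integrable f \<and> (AE x in lebesgue. f x = f x)"
    using sq_integrable_zero by blast
qed (auto intro!: sympI transpI elim: AE_mp)

instantiation l2 :: (euclidean_space, euclidean_space) real_vector
begin

lift_definition zero_l2 :: "('a, 'b) l2" is "\<lambda>x. 0"
  by (simp add: sq_integrable_zero)

lift_definition plus_l2 :: "('a, 'b) l2 \<Rightarrow> ('a, 'b) l2 \<Rightarrow> ('a, 'b) l2" is "\<lambda>f g x. f x + g x"
  by (auto simp: sq_integrable_add)

lift_definition minus_l2 :: "('a, 'b) l2 \<Rightarrow> ('a, 'b) l2 \<Rightarrow> ('a, 'b) l2" is "\<lambda>f g x. f x - g x"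
  by (auto simp: sq_integrable_diff)

lift_definition uminus_l2 :: "('a, 'b) l2 \<Rightarrow> ('a, 'b) l2" is "\<lambda>f x. - f x"
  by (auto simp: sq_integrable_uminus)

lift_definition scaleR_l2 :: "real \<Rightarrow> ('a, 'b) l2 \<Rightarrow> ('a, 'b) l2" is "\<lambda>c f x. c *\<^sub>R f x"
  by (auto simp: sq_integrable_scaleR)

instance
proof
  fix u v w :: "('a, 'b) l2" and r s :: real
  show "u + v + w = u + (v + w)" by transfer (simp add: sq_integrable_add algebra_simps)
  show "u + v = v + u" by transfer (simp add: sq_integrable_add algebra_simps)
  show "0 + u = u" by transfer simp
  show "- u + u = 0" by transfer (simp add: sq_integrable_zero)
  show "u - v = u + - v" by transfer (simp add: sq_integrable_diff)
  show "r *\<^sub>R (u + v) = r *\<^sub>R u + r *\<^sub>R v"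
    by transfer (simp add: sq_integrable_add sq_integrable_scaleR algebra_simps flip: scaleR_add_right)
  show "(r + s) *\<^sub>R u = r *\<^sub>R u + s *\<^sub>R u"
    by transfer (simp add: sq_integrable_add sq_integrable_scaleR scaleR_left_distrib)
  show "r *\<^sub>R s *\<^sub>R u = (r * s) *\<^sub>R u" by transfer (simp add: sq_integrable_scaleR)
  show "1 *\<^sub>R u = u" by transfer simp
qed

end

instantiation l2 :: (euclidean_space, euclidean_space) real_inner
begin

lift_definition inner_l2 :: "('a, 'b) l2 \<Rightarrow> ('a, 'b) l2 \<Rightarrow> real" is "\<lambda>f g. LINT x|lebesgue. f x \<bullet> g x"
proof -
  fix f f' g g' :: "'a \<Rightarrow> 'b"
  assume f: "sq_integrable f \<and> sq_integrable f' \<and> (AE x in lebesgue. f x = f' x)"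
    and g: "sq_integrable g \<and> sq_integrable g' \<and> (AE x in lebesgue. g x = g' x)"
  then have [measurable]: "f \<in> borel_measurable lebesgue" "f' \<in> borel_measurable lebesgue"
    "g \<in> borel_measurable lebesgue" "g' \<in> borel_measurable lebesgue"
    by (auto simp: sq_integrable_def)
  show "(LINT x|lebesgue. f x \<bullet> g x) = (LINT x|lebesgue. f' x \<bullet> g' x)"
    using f g by (intro integral_cong_AE) auto
qed

definition norm_l2 :: "('a, 'b) l2 \<Rightarrow> real" where "norm_l2 v = sqrt (v \<bullet> v)"
definition sgn_l2 :: "('a, 'b) l2 \<Rightarrow> ('a, 'b) l2" where "sgn_l2 v = v /\<^sub>R norm v"
definition dist_l2 :: "('a, 'b) l2 \<Rightarrow> ('a, 'b) l2 \<Rightarrow> real" where "dist_l2 v w = norm (v - w)"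
definition uniformity_l2 :: "(('a, 'b) l2 \<times> ('a, 'b) l2) filter" where
  "uniformity_l2 = (INF e\<in>{0 <..}. principal {(v, w). dist v w < e})"
definition open_l2 :: "('a, 'b) l2 set \<Rightarrow> bool" where
  "open_l2 U \<longleftrightarrow> (\<forall>v\<in>U. eventually (\<lambda>(v', w). v' = v \<longrightarrow> w \<in> U) uniformity)"

instance
proof
  fix u v w :: "('a, 'b) l2" and r :: real
  show "u \<bullet> v = v \<bullet> u" by transfer (simp add: inner_commute)
  show "(u + v) \<bullet> w = u \<bullet> w + v \<bullet> w"
    by transfer (simp add: inner_add_left integrable_inner_sq_integrable)
  show "(r *\<^sub>R u) \<bullet> v = r * (u \<bullet> v)" by transfer simp
  show "0 \<le> u \<bullet> u" by transfer simp
  show "u \<bullet> u = 0 \<longleftrightarrow> u = 0"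
    by transfer (simp add: integrable_inner_sq_integrable sq_integrable_zero integral_nonneg_eq_0_iff_AE)
  show "norm u = sqrt (u \<bullet> u)" by (rule norm_l2_def)
  show "sgn u = u /\<^sub>R norm u" by (rule sgn_l2_def)
  show "dist u v = norm (u - v)" by (rule dist_l2_def)
  show "uniformity = (INF e\<in>{0 <..}. principal {(v, w). dist v (w::('a, 'b) l2) < e})"
    by (rule uniformity_l2_def)
  show "open U \<longleftrightarrow> (\<forall>v\<in>U. eventually (\<lambda>(v', w). v' = v \<longrightarrow> w \<in> U) uniformity)"
    for U :: "('a, 'b) l2 set" by (rule open_l2_def)
qed

end

section \<open>Norm convergence, pointwise convergence and completeness\<close>

lemma power2_norm_l2_abs:
  assumes "sq_integrable f"
  shows "(norm (abs_l2 f))\<^sup>2 = (LINT x|lebesgue. (norm (f x))\<^sup>2)"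
  using assms by (simp add: power2_norm_eq_inner inner_l2.abs_eq)

lemma abs_l2_eq_iff:
  assumes "sq_integrable f" "sq_integrable g"
  shows "abs_l2 f = abs_l2 g \<longleftrightarrow> (AE x in lebesgue. f x = g x)"
  using Quotient3_rel[OF Quotient3_l2, of f g] assms by simp

lemma l2_cases:
  obtains f where "sq_integrable f" "v = abs_l2 f"
  by (induction v rule: l2.abs_induct) blast

text \<open>The decay 4^-k leaves room for weights 2^k: the integrals of the weighted squared
  increments still have a finite sum, so the weighted series is finite almost everywhere, and there
  the increments are absolutely summable. Passing through L1 norms is not an option, as the measure
  of the space is infinite.\<close>

lemma AE_convergent_if_summable_sq_integral:
  fixes f :: "nat \<Rightarrow> 'a::euclidean_space \<Rightarrow> 'b::euclidean_space"
  assumes f: "\<And>k. sq_integrable (f k)"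
    and step: "\<And>k. (LINT x|lebesgue. (norm (f (Suc k) x - f k x))\<^sup>2) \<le> (1/4)^k"
  shows "AE x in lebesgue. convergent (\<lambda>k. f k x)"
proof -
  note [measurable] = f[THEN sq_integrable_measurable]
  define D where "D k x = norm (f (Suc k) x - f k x)" for k x
  have [measurable]: "D k \<in> borel_measurable lebesgue" for k unfolding D_def by measurable
  have "(\<integral>\<^sup>+x. (\<Sum>k. ennreal (2^k * (D k x)\<^sup>2)) \<partial>lebesgue) = (\<Sum>k. \<integral>\<^sup>+x. ennreal (2^k * (D k x)\<^sup>2) \<partial>lebesgue)"
    by (rule nn_integral_suminf) measurable
  also have "\<dots> \<le> (\<Sum>k. ennreal ((1/2)^k))"
  proof (rule suminf_le)
    fix k
    have int: "integrable lebesgue (\<lambda>x. 2^k * (D k x)\<^sup>2)"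
      unfolding D_def using sq_integrable_norm_sq[OF sq_integrable_diff[OF f f]] by simp
    have "(\<integral>\<^sup>+x. ennreal (2^k * (D k x)\<^sup>2) \<partial>lebesgue) = ennreal (2^k * (LINT x|lebesgue. (D k x)\<^sup>2))"
      using int by (subst nn_integral_eq_integral) auto
    also have "\<dots> \<le> ennreal (2^k * (1/4)^k)"
      using step[of k] by (intro ennreal_leI mult_left_mono) (auto simp: D_def)
    also have "2^k * (1/4)^k = ((1/2)^k::real)"
      by (simp flip: power_mult_distrib)
    finally show "(\<integral>\<^sup>+x. ennreal (2^k * (D k x)\<^sup>2) \<partial>lebesgue) \<le> ennreal ((1/2)^k)" .
  qed auto
  also have "\<dots> = ennreal (\<Sum>k. (1/2)^k)"
    by (rule suminf_ennreal2) (auto intro: summable_geometric)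
  also have "\<dots> < \<infinity>" by simp
  finally have "(\<integral>\<^sup>+x. (\<Sum>k. ennreal (2^k * (D k x)\<^sup>2)) \<partial>lebesgue) \<noteq> \<infinity>" by simp
  then have "AE x in lebesgue. (\<Sum>k. ennreal (2^k * (D k x)\<^sup>2)) \<noteq> \<infinity>"
    by (intro nn_integral_PInf_AE) auto
  then show ?thesis
  proof eventually_elim
    case (elim x)
    have s1: "summable (\<lambda>k. 2^k * (D k x)\<^sup>2)"
      using elim by (intro summable_suminf_not_top) auto
    have s2: "summable (\<lambda>k. (1/2::real)^k)" by (rule summable_geometric) simp
    have "summable (\<lambda>k. f (Suc k) x - f k x)"
    proof (rule summable_comparison_test')
      show "summable (\<lambda>k. 2^k * (D k x)\<^sup>2 + (1/2)^k)" by (rule summable_add[OF s1 s2])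
      \<comment> \<open>AM-GM with the two factors \<open>2^(k/2) D\<close> and \<open>2^(-k/2)\<close>.\<close>
      show "norm (f (Suc k) x - f k x) \<le> 2^k * (D k x)\<^sup>2 + (1/2)^k" for k
      proof -
        have "0 \<le> (2^k * D k x - 1)\<^sup>2" by simp
        then have "2 * (2^k * D k x) \<le> 2^k * (2^k * (D k x)\<^sup>2) + 1"
          by (simp add: power2_eq_square algebra_simps)
        also have "\<dots> = 2^k * (2^k * (D k x)\<^sup>2 + (1/2)^k)"
          by (simp add: algebra_simps power_one_over)
        finally have "2 * D k x \<le> 2^k * (D k x)\<^sup>2 + (1/2)^k" by simp
        then show ?thesis
          using norm_ge_zero[of "f (Suc k) x - f k x"] unfolding D_def by linarith
      qed
    qed
    then have "convergent (\<lambda>n. f n x - f 0 x)"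
      by (simp add: summable_iff_convergent sum_lessThan_telescope[of "\<lambda>n. f n x"])
    then show "convergent (\<lambda>k. f k x)"
      using convergent_add_const_iff[of "f 0 x" "\<lambda>n. f n x - f 0 x"] by simp
  qed
qed

text \<open>Fatou's lemma. The bound is asked for only from N on, since it will be applied to f j -
  f k with k fixed, where the estimate holds for j >= k.\<close>

lemma sq_integral_le_if_AE_tendsto:
  fixes f :: "nat \<Rightarrow> 'a::euclidean_space \<Rightarrow> 'b::euclidean_space"
  assumes f: "\<And>k. sq_integrable (f k)" and g: "g \<in> borel_measurable lebesgue"
    and lim: "AE x in lebesgue. (\<lambda>k. f k x) \<longlonglongrightarrow> g x"
    and bound: "\<And>k. k \<ge> N \<Longrightarrow> (LINT x|lebesgue. (norm (f k x))\<^sup>2) \<le> B"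
  shows "sq_integrable g" "(LINT x|lebesgue. (norm (g x))\<^sup>2) \<le> B"
proof -
  note [measurable] = f[THEN sq_integrable_measurable] g
  have B0: "0 \<le> B" using bound[of N]
    by (meson Bochner_Integration.integral_nonneg order_refl order_trans zero_le_power2)
  have "(\<integral>\<^sup>+x. ennreal ((norm (g x))\<^sup>2) \<partial>lebesgue)
      = (\<integral>\<^sup>+x. liminf (\<lambda>k. ennreal ((norm (f k x))\<^sup>2)) \<partial>lebesgue)"
  proof (rule nn_integral_cong_AE)
    show "AE x in lebesgue. ennreal ((norm (g x))\<^sup>2) = liminf (\<lambda>k. ennreal ((norm (f k x))\<^sup>2))"
      using lim
    proof eventually_elim
      case (elim x)
      then have "(\<lambda>k. ennreal ((norm (f k x))\<^sup>2)) \<longlonglongrightarrow> ennreal ((norm (g x))\<^sup>2)"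
        by (intro tendsto_intros)
      then show ?case by (intro lim_imp_Liminf[symmetric]) simp_all
    qed
  qed
  also have "\<dots> \<le> liminf (\<lambda>k. \<integral>\<^sup>+x. ennreal ((norm (f k x))\<^sup>2) \<partial>lebesgue)"
    by (rule nn_integral_liminf) measurable
  also have "\<dots> \<le> limsup (\<lambda>k. \<integral>\<^sup>+x. ennreal ((norm (f k x))\<^sup>2) \<partial>lebesgue)"
    by (rule Liminf_le_Limsup) simp
  also have "\<dots> \<le> ennreal B"
  proof (rule Limsup_bounded)
    show "\<forall>\<^sub>F k in sequentially. (\<integral>\<^sup>+x. ennreal ((norm (f k x))\<^sup>2) \<partial>lebesgue) \<le> ennreal B"
      using eventually_ge_at_top[of N]
    proof eventually_elim
      case (elim k)
      then show ?case
        using bound sq_integrable_norm_sq[OF f] by (subst nn_integral_eq_integral) (auto intro: ennreal_leI)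
    qed
  qed
  finally have le: "(\<integral>\<^sup>+x. ennreal ((norm (g x))\<^sup>2) \<partial>lebesgue) \<le> ennreal B" .
  then have int: "integrable lebesgue (\<lambda>x. (norm (g x))\<^sup>2)"
    by (intro integrableI_bounded) (auto simp: top.not_eq_extremum intro: le_less_trans)
  then show "sq_integrable g" using g by (simp add: sq_integrable_def)
  show "(LINT x|lebesgue. (norm (g x))\<^sup>2) \<le> B"
    using le int B0 by (simp add: nn_integral_eq_integral)
qed

lemma tendsto_abs_l2_iff:
  assumes "\<And>n. sq_integrable (f n)" "sq_integrable g"
  shows "(\<lambda>n. abs_l2 (f n)) \<longlonglongrightarrow> abs_l2 g \<longleftrightarrow>
    (\<lambda>n. LINT x|lebesgue. (norm (f n x - g x))\<^sup>2) \<longlonglongrightarrow> 0"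
proof -
  have "(LINT x|lebesgue. (norm (f n x - g x))\<^sup>2) = (norm (abs_l2 (f n) - abs_l2 g))\<^sup>2" for n
    using assms by (simp add: minus_l2.abs_eq power2_norm_l2_abs sq_integrable_diff)
  moreover have "(\<lambda>n. (norm (abs_l2 (f n) - abs_l2 g))\<^sup>2) \<longlonglongrightarrow> 0 \<longleftrightarrow>
      (\<lambda>n. norm (abs_l2 (f n) - abs_l2 g)) \<longlonglongrightarrow> 0"
    by (rule power_tendsto_0_iff) simp
  ultimately show ?thesis by (simp add: tendsto_norm_zero_iff LIM_zero_iff)
qed

text \<open>Riesz-Fischer: a rapidly Cauchy subsequence converges almost everywhere, Fatou's lemma
  turns the pointwise limit into a norm limit, and a Cauchy sequence follows its convergent
  subsequence.\<close>

instance l2 :: (euclidean_space, euclidean_space) complete_space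
proof
  fix X :: "nat \<Rightarrow> ('a, 'b) l2"
  assume "Cauchy X"
  then have "\<exists>N. \<forall>m\<ge>N. \<forall>n\<ge>N. norm (X m - X n) < (1/2)^k" for k
    by (intro CauchyD) auto
  then obtain N where N: "\<And>k m n. m \<ge> N k \<Longrightarrow> n \<ge> N k \<Longrightarrow> norm (X m - X n) < (1/2)^k"
    by metis
  \<comment> \<open>The sum dominates N k for all k up to the given index at once; the added index
    makes the selection strictly increasing.\<close>
  define r where "r k = k + (\<Sum>i\<le>k. N i)" for k
  have r: "strict_mono r" by (rule strict_monoI_Suc) (simp add: r_def)
  have rN: "N k \<le> r j" if "k \<le> j" for k j
  proof -
    have "N k \<le> (\<Sum>i\<le>j. N i)" using that by (intro member_le_sum) auto
    then show ?thesis by (simp add: r_def)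
  qed
  have "\<exists>f. sq_integrable f \<and> X (r k) = abs_l2 f" for k by (metis l2_cases)
  then obtain f where f: "\<And>k. sq_integrable (f k)" "\<And>k. X (r k) = abs_l2 (f k)" by metis
  note [measurable] = f(1)[THEN sq_integrable_measurable]
  have dist: "(LINT x|lebesgue. (norm (f j x - f k x))\<^sup>2) \<le> (1/4)^k" if "j \<ge> k" for j k
  proof -
    have "(LINT x|lebesgue. (norm (f j x - f k x))\<^sup>2) = (norm (X (r j) - X (r k)))\<^sup>2"
      using f(1) by (simp add: f(2) minus_l2.abs_eq power2_norm_l2_abs sq_integrable_diff)
    also have "\<dots> \<le> ((1/2)^k)\<^sup>2"
      using N[OF rN rN, of k j k] that by (intro power_mono) auto
    also have "\<dots> = (1/4)^k" by (simp add: power2_eq_square flip: power_mult_distrib)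
    finally show ?thesis .
  qed
  \<comment> \<open>Where the sequence diverges, \<open>lim\<close> returns an unspecified value.
    This happens only on a null set, and g is measurable all the same.\<close>
  define g where "g x = lim (\<lambda>k. f k x)" for x
  have [measurable]: "g \<in> borel_measurable lebesgue"
    unfolding g_def by (rule borel_measurable_lim_metric) measurable
  have lim: "AE x in lebesgue. (\<lambda>k. f k x) \<longlonglongrightarrow> g x"
    using AE_convergent_if_summable_sq_integral[OF f(1) dist] by (simp add: g_def convergent_LIMSEQ_iff)
  have lim': "AE x in lebesgue. (\<lambda>j. f j x - f k x) \<longlonglongrightarrow> g x - f k x" for k
    using lim by eventually_elim (intro tendsto_intros)
  have gk: "sq_integrable (\<lambda>x. g x - f k x)" "(LINT x|lebesgue. (norm (g x - f k x))\<^sup>2) \<le> (1/4)^k" for k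
    using sq_integral_le_if_AE_tendsto[OF sq_integrable_diff[OF f(1) f(1)] _ lim' dist] by auto
  have g: "sq_integrable g" using sq_integrable_add[OF gk(1)[of 0] f(1)[of 0]] by simp
  have "(\<lambda>k. X (r k)) \<longlonglongrightarrow> abs_l2 g"
  proof -
    have "(\<lambda>k. LINT x|lebesgue. (norm (g x - f k x))\<^sup>2) \<longlonglongrightarrow> 0"
    proof (rule tendsto_sandwich[OF _ _ tendsto_const])
      show "(\<lambda>k. (1/4::real)^k) \<longlonglongrightarrow> 0" by (rule LIMSEQ_power_zero) simp
    qed (use gk(2) in \<open>auto intro!: always_eventually Bochner_Integration.integral_nonneg\<close>)
    then show ?thesis using f g by (simp add: tendsto_abs_l2_iff norm_minus_commute)
  qed
  then have "X \<longlonglongrightarrow> abs_l2 g"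
    using Cauchy_converges_subseq[OF \<open>Cauchy X\<close> r] by (simp add: o_def)
  then show "convergent X" by (auto simp: convergent_def)
qed

text \<open>The limit inherits the bound, so |f n - g|^2 is dominated by 4 |k|^2. This is how
  pointwise limits of nonlinear expressions in (u, grad u) become limits in the Hilbert
  space.\<close>

lemma tendsto_abs_l2_dominated:
  fixes f :: "nat \<Rightarrow> 'a::euclidean_space \<Rightarrow> 'b::euclidean_space" and k :: "'a \<Rightarrow> 'c::euclidean_space"
  assumes f: "\<And>n. f n \<in> borel_measurable lebesgue" and g: "g \<in> borel_measurable lebesgue"
    and k: "sq_integrable k"
    and lim: "AE x in lebesgue. (\<lambda>n. f n x) \<longlonglongrightarrow> g x"
    and bound: "\<And>n. AE x in lebesgue. norm (f n x) \<le> norm (k x)"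
  shows "(\<lambda>n. abs_l2 (f n)) \<longlonglongrightarrow> abs_l2 g" "sq_integrable (f n)" "sq_integrable g"
proof -
  note [measurable] = f g
  show fi: "sq_integrable (f n)" for n using sq_integrable_bound[OF k f bound] .
  have "AE x in lebesgue. \<forall>n. norm (f n x) \<le> norm (k x)"
    using bound by (simp add: AE_all_countable)
  with lim have gb: "AE x in lebesgue. norm (g x) \<le> norm (k x)"
  proof eventually_elim
    case (elim x)
    then show ?case by (intro LIMSEQ_le_const2[OF tendsto_norm[OF elim(1)]]) auto
  qed
  then show gi: "sq_integrable g" using sq_integrable_bound[OF k g] by blast
  have "(\<lambda>n. LINT x|lebesgue. (norm (f n x - g x))\<^sup>2) \<longlonglongrightarrow> (LINT (x::'a)|lebesgue. 0)"
  proof (rule integral_dominated_convergence)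
    show "integrable lebesgue (\<lambda>x. 4 * (norm (k x))\<^sup>2)" using sq_integrable_norm_sq[OF k] by simp
    show "AE x in lebesgue. (\<lambda>n. (norm (f n x - g x))\<^sup>2) \<longlonglongrightarrow> 0"
      using lim
    proof eventually_elim
      case (elim x)
      then have "(\<lambda>n. norm (f n x - g x)) \<longlonglongrightarrow> 0" by (simp add: LIM_zero tendsto_norm_zero)
      then show ?case using tendsto_power[of _ 0 _ 2] by fastforce
    qed
    show "AE x in lebesgue. norm ((norm (f n x - g x))\<^sup>2) \<le> 4 * (norm (k x))\<^sup>2" for n
      using gb bound[of n]
    proof eventually_elim
      case (elim x)
      then have "norm (f n x - g x) \<le> 2 * norm (k x)"
        using norm_triangle_ineq4[of "f n x" "g x"] by linarith
      then have "(norm (f n x - g x))\<^sup>2 \<le> (2 * norm (k x))\<^sup>2" by (intro power_mono) auto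
      then show ?case by (simp add: power_mult_distrib)
    qed
  qed measurable
  then show "(\<lambda>n. abs_l2 (f n)) \<longlonglongrightarrow> abs_l2 g"
    using fi gi by (simp add: tendsto_abs_l2_iff)
qed

lemma tendsto_abs_l2_AE_subseq:
  assumes "\<And>n. sq_integrable (f n)" "sq_integrable g" "(\<lambda>n. abs_l2 (f n)) \<longlonglongrightarrow> abs_l2 g"
  shows "\<exists>r. strict_mono r \<and> (AE x in lebesgue. (\<lambda>n. f (r n) x) \<longlonglongrightarrow> g x)"
proof -
  have "(\<lambda>n. LINT x|lebesgue. norm ((norm (f n x - g x))\<^sup>2)) \<longlonglongrightarrow> 0"
    using assms by (simp add: tendsto_abs_l2_iff)
  then obtain r where r: "strict_mono r" "AE x in lebesgue. (\<lambda>n. (norm (f (r n) x - g x))\<^sup>2) \<longlonglongrightarrow> 0"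
    using tendsto_L1_AE_subseq[of lebesgue "\<lambda>n x. (norm (f n x - g x))\<^sup>2"]
      sq_integrable_norm_sq[OF sq_integrable_diff[OF assms(1,2)]] by blast
  from r(2) have "AE x in lebesgue. (\<lambda>n. f (r n) x) \<longlonglongrightarrow> g x"
  proof eventually_elim
    case (elim x)
    then have "(\<lambda>n. norm (f (r n) x - g x)) \<longlonglongrightarrow> 0" by (simp add: power_tendsto_0_iff)
    then show ?case by (simp add: tendsto_norm_zero_iff LIM_zero_iff)
  qed
  then show ?thesis using r(1) by blast
qed

section \<open>Test functions\<close>

lemma smooth_fun_differentiable: "smooth_fun f \<Longrightarrow> f differentiable (at x)"
  by (erule smooth_fun.cases) simp

lemma smooth_fun_frechet_derivative: "smooth_fun f \<Longrightarrow> smooth_fun (\<lambda>x. frechet_derivative f (at x) v)"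
  by (erule smooth_fun.cases) simp

lemma smooth_fun_const: "smooth_fun (\<lambda>x::'a::euclidean_space. c)"
proof (coinduction arbitrary: c rule: smooth_fun.coinduct)
  case smooth_fun
  show ?case by (auto simp: frechet_derivative_const)
qed

section \<open>Smooth regularisation of the absolute value\<close>

lemma has_derivative_sqrt_sum_squares:
  assumes "\<delta> \<noteq> (0::real)"
  shows "((\<lambda>s. sqrt (s\<^sup>2 + \<delta>\<^sup>2)) has_field_derivative s * inverse (sqrt (s\<^sup>2 + \<delta>\<^sup>2))) (at s)"
proof -
  have "s\<^sup>2 + \<delta>\<^sup>2 > 0" using assms by (simp add: sum_power2_gt_zero_iff)
  then have "((\<lambda>s. sqrt (s\<^sup>2 + \<delta>\<^sup>2)) has_field_derivative inverse (sqrt (s\<^sup>2 + \<delta>\<^sup>2)) / 2 * (2 * s)) (at s)"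
    by (intro DERIV_chain'[of "\<lambda>s. s\<^sup>2 + \<delta>\<^sup>2", where g = sqrt] DERIV_real_sqrt)
      (auto intro!: derivative_eq_intros)
  then show ?thesis by (simp add: mult.commute)
qed

text \<open>This class is closed under directional derivatives, so it serves as an invariant for proving
  smoothness by coinduction.\<close>

inductive root_algebra :: "real \<Rightarrow> ('a::euclidean_space \<Rightarrow> real) \<Rightarrow> bool" for \<delta> where
  smooth: "smooth_fun f \<Longrightarrow> root_algebra \<delta> f"
| add: "root_algebra \<delta> f \<Longrightarrow> root_algebra \<delta> g \<Longrightarrow> root_algebra \<delta> (\<lambda>x. f x + g x)"
| mult: "root_algebra \<delta> f \<Longrightarrow> root_algebra \<delta> g \<Longrightarrow> root_algebra \<delta> (\<lambda>x. f x * g x)"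
| root: "smooth_fun f \<Longrightarrow> root_algebra \<delta> (\<lambda>x. inverse (sqrt ((f x)\<^sup>2 + \<delta>\<^sup>2)))"

text \<open>The product rule stays within sums and products. The derivative of r = (f^2 +
  \<delta>^2)^(-1/2) is -f' f r^3, again a product of generators; this is the reason for taking the
  inverse root, and not the root, as a generator.\<close>

lemma root_algebra_derivative:
  assumes "root_algebra \<delta> f" "\<delta> \<noteq> 0"
  shows "(\<forall>x. f differentiable (at x)) \<and> (\<forall>v. root_algebra \<delta> (\<lambda>x. frechet_derivative f (at x) v))"
  using assms(1)
proof induction
  case (smooth f)
  then show ?case
    by (auto intro: smooth_fun_differentiable smooth_fun_frechet_derivative root_algebra.smooth)
next
  case (add f g)
  then have "((\<lambda>x. f x + g x) has_derivative
      (\<lambda>v. frechet_derivative f (at x) v + frechet_derivative g (at x) v)) (at x)" for x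
    by (intro has_derivative_add) (auto simp flip: frechet_derivative_works)
  note D = this differentiableI[OF this] frechet_derivative_at[OF this, symmetric]
  show ?case using add.IH by (simp add: D root_algebra.add)
next
  case (mult f g)
  then have "((\<lambda>x. f x * g x) has_derivative
      (\<lambda>v. f x * frechet_derivative g (at x) v + frechet_derivative f (at x) v * g x)) (at x)" for x
    by (intro has_derivative_mult) (auto simp flip: frechet_derivative_works)
  note D = this differentiableI[OF this] frechet_derivative_at[OF this, symmetric]
  show ?case using mult by (simp add: D root_algebra.add root_algebra.mult)
next
  case (root f)
  let ?r = "\<lambda>x. inverse (sqrt ((f x)\<^sup>2 + \<delta>\<^sup>2))"
  have D: "((\<lambda>s. inverse (sqrt (s\<^sup>2 + \<delta>\<^sup>2))) has_field_derivative
      (-1) * (s * (inverse (sqrt (s\<^sup>2 + \<delta>\<^sup>2)) * (inverse (sqrt (s\<^sup>2 + \<delta>\<^sup>2)) * inverse (sqrt (s\<^sup>2 + \<delta>\<^sup>2)))))) (at s)" for s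
  proof (rule DERIV_cong[OF DERIV_inverse_fun[OF has_derivative_sqrt_sum_squares[OF assms(2)]]])
    have "- (s * inverse r * inverse (r ^ Suc (Suc 0))) = (-1) * (s * (inverse r * (inverse r * inverse r)))"
      for r by simp
    then show "- (s * inverse (sqrt (s\<^sup>2 + \<delta>\<^sup>2)) * inverse (sqrt (s\<^sup>2 + \<delta>\<^sup>2) ^ Suc (Suc 0))) =
      (-1) * (s * (inverse (sqrt (s\<^sup>2 + \<delta>\<^sup>2)) * (inverse (sqrt (s\<^sup>2 + \<delta>\<^sup>2)) * inverse (sqrt (s\<^sup>2 + \<delta>\<^sup>2)))))" .
  qed (use assms(2) in simp)
  have "(?r has_derivative (\<lambda>v. frechet_derivative f (at x) v *
      ((-1) * (f x * (?r x * (?r x * ?r x)))))) (at x)" for x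
    by (rule DERIV_compose_FDERIV[OF D])
      (use root smooth_fun_differentiable frechet_derivative_works in blast)
  note D = this differentiableI[OF this] frechet_derivative_at[OF this, symmetric]
  have "root_algebra \<delta> (\<lambda>x. frechet_derivative f (at x) v * ((-1) * (f x * (?r x * (?r x * ?r x)))))" for v
    using root by (intro root_algebra.mult root_algebra.root root_algebra.smooth smooth_fun_const
        smooth_fun_frechet_derivative)
  then show ?case by (simp add: D)
qed

lemma smooth_fun_root_algebra:
  assumes "root_algebra \<delta> f" "\<delta> \<noteq> 0"
  shows "smooth_fun f"
  using assms(1)
proof (coinduction arbitrary: f rule: smooth_fun.coinduct)
  case (smooth_fun f)
  then show ?case using root_algebra_derivative[OF _ assms(2)] by blast
qed

lemma smooth_fun_add: "smooth_fun f \<Longrightarrow> smooth_fun g \<Longrightarrow> smooth_fun (\<lambda>x. f x + g x)"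
  by (rule smooth_fun_root_algebra[of 1]) (auto intro: root_algebra.intros)

text \<open>Products alone are no invariant for coinduction, since the product rule yields sums of
  products; hence the detour through the algebra, with 1 as an arbitrary nonzero parameter.\<close>

lemma smooth_fun_mult: "smooth_fun f \<Longrightarrow> smooth_fun g \<Longrightarrow> smooth_fun (\<lambda>x. f x * g x)"
  by (rule smooth_fun_root_algebra[of 1]) (auto intro: root_algebra.intros)

text \<open>Subtracting \<delta> makes the regularised absolute value vanish at 0, so that composing
  it with a test function creates no new support.\<close>

definition smooth_abs :: "real \<Rightarrow> real \<Rightarrow> real" where
  "smooth_abs \<delta> s = sqrt (s\<^sup>2 + \<delta>\<^sup>2) - \<delta>"

lemma smooth_fun_smooth_abs:
  assumes "smooth_fun f" "\<delta> > 0"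
  shows "smooth_fun (\<lambda>x. smooth_abs \<delta> (f x))"
proof -
  have "root_algebra \<delta> (\<lambda>x. (f x * f x + \<delta>\<^sup>2) * inverse (sqrt ((f x)\<^sup>2 + \<delta>\<^sup>2)) + (- \<delta>))"
    using assms(1) by (intro root_algebra.add root_algebra.mult root_algebra.root
        root_algebra.smooth[OF smooth_fun_const] root_algebra.smooth) auto
  \<comment> \<open>The identity sqrt y = y / sqrt y expresses the root through the generators of
    the algebra.\<close>
  moreover have "smooth_abs \<delta> s = (s * s + \<delta>\<^sup>2) * inverse (sqrt (s\<^sup>2 + \<delta>\<^sup>2)) + (- \<delta>)" for s
    using real_div_sqrt[of "s\<^sup>2 + \<delta>\<^sup>2"] by (simp add: smooth_abs_def divide_inverse power2_eq_square)
  ultimately show ?thesis using assms(2) by (auto intro: smooth_fun_root_algebra)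
qed

section \<open>Gradients and the vector space of test functions\<close>

lemma has_derivative_grad:
  assumes "smooth_fun f"
  shows "(f has_derivative (\<lambda>v. grad f x \<bullet> v)) (at x)"
proof -
  let ?D = "frechet_derivative f (at x)"
  have D: "(f has_derivative ?D) (at x)"
    using assms smooth_fun_differentiable frechet_derivative_works by blast
  then have lin: "linear ?D" using has_derivative_bounded_linear bounded_linear.linear by blast
  have "?D = (\<lambda>v. grad f x \<bullet> v)"
  proof
    fix v
    have "?D v = ?D (\<Sum>b\<in>Basis. (v \<bullet> b) *\<^sub>R b)" by (simp add: euclidean_representation)
    also have "\<dots> = (\<Sum>b\<in>Basis. (v \<bullet> b) * ?D b)"
      using lin by (simp add: linear_sum linear_scale)
    also have "\<dots> = grad f x \<bullet> v"
      by (simp add: grad_def inner_sum_right inner_commute[of _ v] mult.commute)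
    finally show "?D v = grad f x \<bullet> v" .
  qed
  then show ?thesis using D by simp
qed

lemma grad_unique:
  assumes "(f has_derivative (\<lambda>v. w \<bullet> v)) (at x)"
  shows "grad f x = w"
  using frechet_derivative_at[OF assms, symmetric] by (simp add: grad_def euclidean_representation)

lemma continuous_on_smooth_fun: "smooth_fun f \<Longrightarrow> continuous_on A f"
  by (intro continuous_at_imp_continuous_on ballI differentiable_imp_continuous_within
      smooth_fun_differentiable)

lemma continuous_on_grad: "smooth_fun f \<Longrightarrow> continuous_on A (grad f)"
  unfolding grad_def
  by (intro continuous_intros continuous_on_smooth_fun smooth_fun_frechet_derivative)

lemma test_funI:
  assumes "smooth_fun f" "compact K" "K \<subseteq> \<Omega>" "\<And>x. x \<notin> K \<Longrightarrow> f x = 0"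
  shows "test_fun \<Omega> f"
proof -
  have "fsupport f \<subseteq> K"
    unfolding fsupport_def using assms(2,4) by (intro closure_minimal compact_imp_closed) auto
  moreover have "closed (fsupport f)" by (simp add: fsupport_def)
  ultimately show ?thesis
    using assms(1-3) unfolding test_fun_def by (metis compact_Int_closed inf.absorb_iff2 subset_trans)
qed

lemma test_fun_smooth: "test_fun \<Omega> f \<Longrightarrow> smooth_fun f"
  by (simp add: test_fun_def)

lemma fsupport_zero: "x \<notin> fsupport f \<Longrightarrow> f x = 0"
  using closure_subset[of "{x. f x \<noteq> 0}"] by (auto simp: fsupport_def)

lemma grad_zero_outside_fsupport:
  assumes "x \<notin> fsupport f" shows "grad f x = 0"
proof (rule grad_unique)
  have "open (- fsupport f)" unfolding fsupport_def by (intro open_Compl closed_closure)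
  then have "(f has_derivative (\<lambda>v. 0)) (at x)"
    by (rule has_derivative_transform_within_open[OF has_derivative_const, of _ x])
      (use assms in \<open>auto simp: fsupport_zero\<close>)
  then show "(f has_derivative (\<lambda>v. 0 \<bullet> v)) (at x)" by simp
qed

lemma test_fun_lincomb:
  assumes f: "test_fun \<Omega> f" and g: "test_fun \<Omega> g"
  shows "test_fun \<Omega> (\<lambda>x. a * f x + b * g x)"
    and "grad (\<lambda>x. a * f x + b * g x) x = a *\<^sub>R grad f x + b *\<^sub>R grad g x"
proof -
  show "test_fun \<Omega> (\<lambda>x. a * f x + b * g x)"
  proof (rule test_funI)
    show "smooth_fun (\<lambda>x. a * f x + b * g x)"
      by (intro smooth_fun_add smooth_fun_mult smooth_fun_const f[THEN test_fun_smooth] g[THEN test_fun_smooth])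
    show "compact (fsupport f \<union> fsupport g)" "fsupport f \<union> fsupport g \<subseteq> \<Omega>"
      using f g by (auto simp: test_fun_def)
  qed (simp add: fsupport_zero)
  show "grad (\<lambda>x. a * f x + b * g x) x = a *\<^sub>R grad f x + b *\<^sub>R grad g x"
    by (rule grad_unique) (auto intro!: derivative_eq_intros has_derivative_grad f[THEN test_fun_smooth] g[THEN test_fun_smooth]
        simp: inner_add_left)
qed

lemma test_fun_zero: "test_fun \<Omega> (\<lambda>x. 0)"
  by (rule test_funI[of _ "{}"]) (auto intro: smooth_fun_const)

lemma smooth_abs_has_derivative:
  assumes "\<delta> > 0"
  shows "(smooth_abs \<delta> has_field_derivative s / sqrt (s\<^sup>2 + \<delta>\<^sup>2)) (at s)"
  using DERIV_diff[OF has_derivative_sqrt_sum_squares[of \<delta> s] DERIV_const[of \<delta>]] assms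
  by (simp add: smooth_abs_def[abs_def] divide_inverse)

lemma test_fun_smooth_abs:
  assumes f: "test_fun \<Omega> f" and "\<delta> > 0"
  shows "test_fun \<Omega> (\<lambda>x. smooth_abs \<delta> (f x))"
    and "grad (\<lambda>x. smooth_abs \<delta> (f x)) x = (f x / sqrt ((f x)\<^sup>2 + \<delta>\<^sup>2)) *\<^sub>R grad f x"
proof -
  show "test_fun \<Omega> (\<lambda>x. smooth_abs \<delta> (f x))"
  proof (rule test_funI[of _ "fsupport f"])
    show "smooth_fun (\<lambda>x. smooth_abs \<delta> (f x))"
      using f assms(2) by (simp add: smooth_fun_smooth_abs test_fun_smooth)
    show "smooth_abs \<delta> (f x) = 0" if "x \<notin> fsupport f" for x
      using fsupport_zero[OF that] assms(2) by (simp add: smooth_abs_def)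
  qed (use f in \<open>auto simp: test_fun_def\<close>)
  have "((\<lambda>x. smooth_abs \<delta> (f x)) has_derivative (\<lambda>v. grad f x \<bullet> v * (f x / sqrt ((f x)\<^sup>2 + \<delta>\<^sup>2)))) (at x)"
    by (rule DERIV_compose_FDERIV[OF smooth_abs_has_derivative[OF assms(2)] has_derivative_grad[OF test_fun_smooth[OF f]]])
  then show "grad (\<lambda>x. smooth_abs \<delta> (f x)) x = (f x / sqrt ((f x)\<^sup>2 + \<delta>\<^sup>2)) *\<^sub>R grad f x"
    by (intro grad_unique) (simp only: inner_scaleR_left mult.commute)
qed

section \<open>The energy space\<close>

lemma norm_abs_l2_mono:
  assumes "sq_integrable f" "sq_integrable g" "AE x in lebesgue. norm (f x) \<le> norm (g x)"
  shows "norm (abs_l2 f) \<le> norm (abs_l2 g)"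
proof (rule power2_le_imp_le)
  have "(LINT x|lebesgue. (norm (f x))\<^sup>2) \<le> (LINT x|lebesgue. (norm (g x))\<^sup>2)"
    using assms(3) by (intro integral_mono_AE sq_integrable_norm_sq assms(1,2)) (auto simp: power_mono)
  then show "(norm (abs_l2 f))\<^sup>2 \<le> (norm (abs_l2 g))\<^sup>2"
    using assms(1,2) by (simp add: power2_norm_l2_abs)
qed simp

lemma sq_integrable_fst:
  fixes f :: "'a::euclidean_space \<Rightarrow> 'b::euclidean_space \<times> 'c::euclidean_space"
  assumes "sq_integrable f" shows "sq_integrable (\<lambda>x. fst (f x))"
proof (rule sq_integrable_bound[OF assms])
  show "(\<lambda>x. fst (f x)) \<in> borel_measurable lebesgue"
    using sq_integrable_measurable[OF assms]
    by (rule measurable_compose) (auto intro!: borel_measurable_continuous_onI continuous_intros)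
  show "AE x in lebesgue. norm (fst (f x)) \<le> norm (f x)"
    by (intro always_eventually allI) (metis norm_fst_le prod.collapse)
qed

lemma sq_integrable_snd:
  fixes f :: "'a::euclidean_space \<Rightarrow> 'b::euclidean_space \<times> 'c::euclidean_space"
  assumes "sq_integrable f" shows "sq_integrable (\<lambda>x. snd (f x))"
proof (rule sq_integrable_bound[OF assms])
  show "(\<lambda>x. snd (f x)) \<in> borel_measurable lebesgue"
    using sq_integrable_measurable[OF assms]
    by (rule measurable_compose) (auto intro!: borel_measurable_continuous_onI continuous_intros)
  show "AE x in lebesgue. norm (snd (f x)) \<le> norm (f x)"
    by (intro always_eventually allI) (metis norm_snd_le prod.collapse)
qed

lemma sq_integrable_Pair:
  fixes f :: "'a::euclidean_space \<Rightarrow> 'b::euclidean_space" and g :: "'a \<Rightarrow> 'c::euclidean_space"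
  assumes "sq_integrable f" "sq_integrable g" shows "sq_integrable (\<lambda>x. (f x, g x))"
proof -
  have "sq_integrable (\<lambda>x. (f x, 0::'c))" "sq_integrable (\<lambda>x. (0::'b, g x))"
    using assms by (auto intro: sq_integrable_bound[OF assms(1)] sq_integrable_bound[OF assms(2)]
        dest: sq_integrable_measurable)
  from sq_integrable_add[OF this] show ?thesis by simp
qed

lemma sq_integrable_mult_bounded:
  fixes f :: "'a::euclidean_space \<Rightarrow> 'b::euclidean_space" and a :: "'a \<Rightarrow> real"
  assumes "sq_integrable f" "a \<in> borel_measurable lebesgue" "\<And>x. \<bar>a x\<bar> \<le> 1"
  shows "sq_integrable (\<lambda>x. a x *\<^sub>R f x)"
  by (rule sq_integrable_bound[OF assms(1)])
    (use assms in \<open>auto intro!: borel_measurable_scaleR mult_left_le_one_le dest: sq_integrable_measurable\<close>)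

lemma L2_iff_sq_integrable: "L2 \<Omega> u \<longleftrightarrow> sq_integrable (\<lambda>x. indicator \<Omega> x * u x)"
proof -
  have "(norm (indicator \<Omega> x * u x))\<^sup>2 = indicator \<Omega> x *\<^sub>R (u x)\<^sup>2" for x
    by (simp add: indicator_def)
  then show ?thesis
    by (simp add: L2_def sq_integrable_def set_borel_measurable_def set_integrable_def)
qed

lemma L2v_iff_sq_integrable: "L2v \<Omega> g \<longleftrightarrow> sq_integrable (\<lambda>x. indicator \<Omega> x *\<^sub>R g x)"
proof -
  have "(norm (indicator \<Omega> x *\<^sub>R g x))\<^sup>2 = indicator \<Omega> x *\<^sub>R (norm (g x))\<^sup>2" for x
    by (simp add: indicator_def)
  then show ?thesis
    by (simp add: L2v_def sq_integrable_def set_borel_measurable_def set_integrable_def)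
qed

definition jet :: "('a::euclidean_space \<Rightarrow> real) \<Rightarrow> 'a \<Rightarrow> real \<times> 'a" where
  "jet \<phi> x = (\<phi> x, grad \<phi> x)"

text \<open>A type cannot depend on the set \<Omega>. With extension by zero a single Hilbert space
  serves every \<Omega>, and the domain is felt only through the subspace
  \<open>energy_space\<close>.\<close>

definition zero_ext :: "'a::euclidean_space set \<Rightarrow> ('a \<Rightarrow> real) \<Rightarrow> ('a \<Rightarrow> 'a) \<Rightarrow> 'a \<Rightarrow> real \<times> 'a" where
  "zero_ext \<Omega> u g x = (indicator \<Omega> x * u x, indicator \<Omega> x *\<^sub>R g x)"

text \<open>The gradient is carried as a component of the pair and is never derived from the
  function, so everything about H^1_0 reduces to closedness and limits of test functions, without a
  calculus of weak derivatives.\<close>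

definition energy_space :: "'a::euclidean_space set \<Rightarrow> ('a, real \<times> 'a) l2 set" where
  "energy_space \<Omega> = closure {abs_l2 (jet \<phi>) | \<phi>. test_fun \<Omega> \<phi>}"

lemma sq_integrable_zero_ext_iff:
  "sq_integrable (zero_ext \<Omega> u g) \<longleftrightarrow> L2 \<Omega> u \<and> L2v \<Omega> g"
  unfolding L2_iff_sq_integrable L2v_iff_sq_integrable zero_ext_def[abs_def]
  using sq_integrable_fst[of "\<lambda>x. (indicator \<Omega> x * u x, indicator \<Omega> x *\<^sub>R g x)"]
    sq_integrable_snd[of "\<lambda>x. (indicator \<Omega> x * u x, indicator \<Omega> x *\<^sub>R g x)"]
    sq_integrable_Pair by auto

lemma sq_integrable_jet:
  assumes "test_fun \<Omega> \<phi>" shows "sq_integrable (jet \<phi>)"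
proof -
  let ?K = "fsupport \<phi>"
  have cont: "continuous_on A (jet \<phi>)" for A
    unfolding jet_def[abs_def]
    using assms by (intro continuous_intros continuous_on_smooth_fun continuous_on_grad) (auto simp: test_fun_def)
  then have m: "jet \<phi> \<in> borel_measurable borel" by (rule borel_measurable_continuous_onI)
  have "integrable lborel (\<lambda>x. indicator ?K x *\<^sub>R (norm (jet \<phi> x))\<^sup>2)"
    using assms cont by (intro borel_integrable_compact continuous_intros) (auto simp: test_fun_def)
  moreover have "indicator ?K x *\<^sub>R (norm (jet \<phi> x))\<^sup>2 = (norm (jet \<phi> x))\<^sup>2" for x
    by (cases "x \<in> ?K") (auto simp: jet_def fsupport_zero grad_zero_outside_fsupport)
  ultimately have "integrable lborel (\<lambda>x. (norm (jet \<phi> x))\<^sup>2)" by (simp only:)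
  then have "integrable lebesgue (\<lambda>x. (norm (jet \<phi> x))\<^sup>2)"
    using m by (subst integrable_completion) auto
  moreover have "jet \<phi> \<in> borel_measurable lebesgue"
    using m by (intro measurable_completion) simp
  ultimately show ?thesis by (simp add: sq_integrable_def)
qed

lemma jet_zero_outside:
  assumes "test_fun \<Omega> \<phi>" "x \<notin> \<Omega>" shows "\<phi> x = 0" "grad \<phi> x = 0"
  using assms fsupport_zero[of x \<phi>] grad_zero_outside_fsupport[of x \<phi>] by (auto simp: test_fun_def)

lemma subspace_closure:
  fixes S :: "'a::real_normed_vector set"
  assumes "subspace S" shows "subspace (closure S)"
proof (rule subspaceI)
  show "0 \<in> closure S" using assms closure_subset subspace_0 by blast
  fix x y c assume x: "x \<in> closure S" and y: "y \<in> closure S"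
  obtain X Y where X: "\<And>n. X n \<in> S" "X \<longlonglongrightarrow> x" and Y: "\<And>n. Y n \<in> S" "Y \<longlonglongrightarrow> y"
    using x y unfolding closure_sequential by blast
  have "\<And>n. X n + Y n \<in> S" "(\<lambda>n. X n + Y n) \<longlonglongrightarrow> x + y"
    using X Y assms by (auto simp: subspace_add tendsto_add)
  then show "x + y \<in> closure S" unfolding closure_sequential by (intro exI[of _ "\<lambda>n. X n + Y n"]) simp
  have "\<And>n. c *\<^sub>R X n \<in> S" "(\<lambda>n. c *\<^sub>R X n) \<longlonglongrightarrow> c *\<^sub>R x"
    using X assms by (auto simp: subspace_scale tendsto_scaleR)
  then show "c *\<^sub>R x \<in> closure S" unfolding closure_sequential by (intro exI[of _ "\<lambda>n. c *\<^sub>R X n"]) simp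
qed

lemma subspace_energy_space: "subspace (energy_space \<Omega>)"
proof -
  let ?J = "{abs_l2 (jet \<phi>) | \<phi>. test_fun \<Omega> \<phi>}"
  have lin: "a *\<^sub>R abs_l2 (jet \<phi>) + b *\<^sub>R abs_l2 (jet \<psi>) \<in> ?J" if "test_fun \<Omega> \<phi>" "test_fun \<Omega> \<psi>" for a b \<phi> \<psi>
  proof -
    have "jet (\<lambda>x. a * \<phi> x + b * \<psi> x) = (\<lambda>x. a *\<^sub>R jet \<phi> x + b *\<^sub>R jet \<psi> x)"
      by (simp add: fun_eq_iff jet_def test_fun_lincomb(2)[OF that])
    then have "a *\<^sub>R abs_l2 (jet \<phi>) + b *\<^sub>R abs_l2 (jet \<psi>) = abs_l2 (jet (\<lambda>x. a * \<phi> x + b * \<psi> x))"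
      using that by (simp add: scaleR_l2.abs_eq plus_l2.abs_eq sq_integrable_jet sq_integrable_scaleR)
    then show ?thesis using test_fun_lincomb(1)[OF that] by blast
  qed
  have "subspace ?J"
  proof (rule subspaceI)
    obtain \<phi> :: "'a \<Rightarrow> real" where z: "test_fun \<Omega> \<phi>" using test_fun_zero by blast
    show "0 \<in> ?J" using lin[OF z z, of 0 0] by simp
    show "v + w \<in> ?J" if "v \<in> ?J" "w \<in> ?J" for v w
      using that lin[of _ _ 1 1] by auto
    show "c *\<^sub>R v \<in> ?J" if "v \<in> ?J" for c v
      using that lin[of _ _ c 0] by auto
  qed
  then show ?thesis unfolding energy_space_def by (rule subspace_closure)
qed

lemma closed_energy_space: "closed (energy_space \<Omega>)"
  by (simp add: energy_space_def)

lemma energy_space_sequence: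
  assumes "sq_integrable f" "abs_l2 f \<in> energy_space \<Omega>"
  obtains \<phi> where "\<And>n. test_fun \<Omega> (\<phi> n)" "(\<lambda>n. abs_l2 (jet (\<phi> n))) \<longlonglongrightarrow> abs_l2 f"
    "AE x in lebesgue. (\<lambda>n. jet (\<phi> n) x) \<longlonglongrightarrow> f x"
proof -
  obtain X where X: "\<And>n. X n \<in> {abs_l2 (jet \<phi>) | \<phi>. test_fun \<Omega> \<phi>}" "X \<longlonglongrightarrow> abs_l2 f"
    using assms(2) by (auto simp: energy_space_def closure_sequential)
  then have "\<exists>\<phi>. test_fun \<Omega> \<phi> \<and> X n = abs_l2 (jet \<phi>)" for n by blast
  then obtain \<phi> where \<phi>: "\<And>n. test_fun \<Omega> (\<phi> n)" "\<And>n. X n = abs_l2 (jet (\<phi> n))" by metis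
  have lim: "(\<lambda>n. abs_l2 (jet (\<phi> n))) \<longlonglongrightarrow> abs_l2 f" using X(2) by (simp flip: \<phi>(2))
  obtain r where r: "strict_mono r" "AE x in lebesgue. (\<lambda>n. jet (\<phi> (r n)) x) \<longlonglongrightarrow> f x"
    using tendsto_abs_l2_AE_subseq[OF sq_integrable_jet[OF \<phi>(1)] assms(1) lim] by blast
  show ?thesis
    by (rule that[of "\<lambda>n. \<phi> (r n)"])
      (use \<phi>(1) r LIMSEQ_subseq_LIMSEQ[OF lim r(1)] in \<open>auto simp: o_def\<close>)
qed

text \<open>The squared distance of the pairs is the sum of the two integrals in \<open>H10\<close>.
  Both are nonnegative, so the sum tends to 0 exactly when each does. Outside \<Omega> nothing is
  contributed, because test functions and their gradients vanish there.\<close>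

lemma H10_iff_energy_space:
  "H10 \<Omega> u g \<longleftrightarrow> sq_integrable (zero_ext \<Omega> u g) \<and> abs_l2 (zero_ext \<Omega> u g) \<in> energy_space \<Omega>"
proof (cases "L2 \<Omega> u \<and> L2v \<Omega> g")
  case True
  then have sq: "sq_integrable (zero_ext \<Omega> u g)" by (simp add: sq_integrable_zero_ext_iff)
  have conv: "(\<lambda>n. abs_l2 (jet (\<phi> n))) \<longlonglongrightarrow> abs_l2 (zero_ext \<Omega> u g) \<longleftrightarrow>
     (\<lambda>n. LINT x:\<Omega>|lebesgue. (\<phi> n x - u x)\<^sup>2) \<longlonglongrightarrow> 0 \<and>
     (\<lambda>n. LINT x:\<Omega>|lebesgue. (norm (grad (\<phi> n) x - g x))\<^sup>2) \<longlonglongrightarrow> 0"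
    if \<phi>: "\<And>n. test_fun \<Omega> (\<phi> n)" for \<phi> :: "nat \<Rightarrow> 'a \<Rightarrow> real"
  proof -
    define A where "A n = (LINT x:\<Omega>|lebesgue. (\<phi> n x - u x)\<^sup>2)" for n
    define B where "B n = (LINT x:\<Omega>|lebesgue. (norm (grad (\<phi> n) x - g x))\<^sup>2)" for n
    have nonneg: "0 \<le> A n" "0 \<le> B n" for n
      by (auto simp: A_def B_def set_lebesgue_integral_def intro!: Bochner_Integration.integral_nonneg)
    have "(LINT x|lebesgue. (norm (jet (\<phi> n) x - zero_ext \<Omega> u g x))\<^sup>2) = A n + B n" for n
    proof -
      let ?d = "\<lambda>x. jet (\<phi> n) x - zero_ext \<Omega> u g x"
      have d: "sq_integrable ?d" by (rule sq_integrable_diff[OF sq_integrable_jet[OF \<phi>] sq])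
      have e: "?d x = (indicator \<Omega> x * (\<phi> n x - u x), indicator \<Omega> x *\<^sub>R (grad (\<phi> n) x - g x))" for x
        using jet_zero_outside[OF \<phi>[of n], of x] by (auto simp: jet_def zero_ext_def indicator_def)
      have n1: "(norm (fst (?d x)))\<^sup>2 = indicator \<Omega> x *\<^sub>R (\<phi> n x - u x)\<^sup>2"
        and n2: "(norm (snd (?d x)))\<^sup>2 = indicator \<Omega> x *\<^sub>R (norm (grad (\<phi> n) x - g x))\<^sup>2" for x
        unfolding e by (auto simp: indicator_def)
      have "(LINT x|lebesgue. (norm (?d x))\<^sup>2) = (LINT x|lebesgue. (norm (fst (?d x)))\<^sup>2 + (norm (snd (?d x)))\<^sup>2)"
        by (intro Bochner_Integration.integral_cong refl) (simp add: norm_prod_def)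
      also have "\<dots> = (LINT x|lebesgue. (norm (fst (?d x)))\<^sup>2) + (LINT x|lebesgue. (norm (snd (?d x)))\<^sup>2)"
        by (intro Bochner_Integration.integral_add sq_integrable_norm_sq sq_integrable_fst sq_integrable_snd d)
      also have "\<dots> = A n + B n"
        unfolding A_def B_def set_lebesgue_integral_def n1 n2 ..
      finally show ?thesis .
    qed
    then have "(\<lambda>n. abs_l2 (jet (\<phi> n))) \<longlonglongrightarrow> abs_l2 (zero_ext \<Omega> u g) \<longleftrightarrow> (\<lambda>n. A n + B n) \<longlonglongrightarrow> 0"
      using tendsto_abs_l2_iff[OF sq_integrable_jet[OF \<phi>] sq] by simp
    also have "\<dots> \<longleftrightarrow> A \<longlonglongrightarrow> 0 \<and> B \<longlonglongrightarrow> 0"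
    proof
      assume AB: "(\<lambda>n. A n + B n) \<longlonglongrightarrow> 0"
      have "A \<longlonglongrightarrow> 0" by (rule tendsto_sandwich[OF _ _ tendsto_const AB]) (auto simp: nonneg)
      moreover have "B \<longlonglongrightarrow> 0" by (rule tendsto_sandwich[OF _ _ tendsto_const AB]) (auto simp: nonneg)
      ultimately show "A \<longlonglongrightarrow> 0 \<and> B \<longlonglongrightarrow> 0" by simp
    qed (use tendsto_add[of A 0 _ B 0] in auto)
    finally show ?thesis by (simp add: A_def[abs_def] B_def[abs_def])
  qed
  show ?thesis
  proof
    assume "H10 \<Omega> u g"
    then obtain \<phi> where \<phi>: "\<And>n. test_fun \<Omega> (\<phi> n)" "(\<lambda>n. abs_l2 (jet (\<phi> n))) \<longlonglongrightarrow> abs_l2 (zero_ext \<Omega> u g)"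
      unfolding H10_def using conv by blast
    then have "abs_l2 (zero_ext \<Omega> u g) \<in> energy_space \<Omega>"
      unfolding energy_space_def closure_sequential
      by (intro exI[of _ "\<lambda>n. abs_l2 (jet (\<phi> n))"]) blast
    then show "sq_integrable (zero_ext \<Omega> u g) \<and> abs_l2 (zero_ext \<Omega> u g) \<in> energy_space \<Omega>" using sq by simp
  next
    assume *: "sq_integrable (zero_ext \<Omega> u g) \<and> abs_l2 (zero_ext \<Omega> u g) \<in> energy_space \<Omega>"
    obtain \<phi> where "\<And>n. test_fun \<Omega> (\<phi> n)" "(\<lambda>n. abs_l2 (jet (\<phi> n))) \<longlonglongrightarrow> abs_l2 (zero_ext \<Omega> u g)"
      by (rule energy_space_sequence[of "zero_ext \<Omega> u g" \<Omega>]) (use * that in auto)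
    then show "H10 \<Omega> u g" unfolding H10_def using conv True by blast
  qed
next
  case False
  then show ?thesis by (auto simp: H10_def sq_integrable_zero_ext_iff)
qed

text \<open>Jets of suitable test functions converge to f almost everywhere, and all of them vanish
  outside \<Omega>. This permits switching between integrals over \<Omega> and over the whole
  space.\<close>

lemma energy_space_zero_outside:
  assumes "sq_integrable f" "abs_l2 f \<in> energy_space \<Omega>"
  shows "AE x in lebesgue. f x = zero_ext \<Omega> (\<lambda>x. fst (f x)) (\<lambda>x. snd (f x)) x"
proof -
  obtain \<phi> where \<phi>: "\<And>n. test_fun \<Omega> (\<phi> n)" and lim: "AE x in lebesgue. (\<lambda>n. jet (\<phi> n) x) \<longlonglongrightarrow> f x"
    by (rule energy_space_sequence[OF assms]) (rule that)
  from lim show ?thesis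
  proof eventually_elim
    case (elim x)
    show ?case
    proof (cases "x \<in> \<Omega>")
      case False
      then have "jet (\<phi> n) x = 0" for n using jet_zero_outside[OF \<phi>] by (simp add: jet_def zero_prod_def)
      then have "f x = 0" using elim LIMSEQ_unique tendsto_const by (metis (no_types, lifting) ext)
      then show ?thesis by (simp add: zero_ext_def zero_prod_def)
    qed (simp add: zero_ext_def)
  qed
qed

section \<open>Stability of the energy space under absolute values and positive parts\<close>

lemma smooth_abs_lipschitz: "\<bar>smooth_abs \<delta> s - smooth_abs \<delta> t\<bar> \<le> \<bar>s - t\<bar>"
proof -
  have "\<bar>norm (s, \<delta>) - norm (t, \<delta>)\<bar> \<le> norm ((s, \<delta>) - (t, \<delta>))" by (rule norm_triangle_ineq3)
  then show ?thesis by (simp add: smooth_abs_def norm_Pair)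
qed

lemma abs_smooth_abs_le: "\<delta> > 0 \<Longrightarrow> \<bar>smooth_abs \<delta> s\<bar> \<le> \<bar>s\<bar>"
  using smooth_abs_lipschitz[of \<delta> s 0] by (simp add: smooth_abs_def)

lemma abs_divide_sqrt_sum_squares_le: "\<bar>s / sqrt (s\<^sup>2 + \<delta>\<^sup>2)\<bar> \<le> 1"
proof -
  have "\<bar>s\<bar> \<le> sqrt (s\<^sup>2 + \<delta>\<^sup>2)" by (simp add: real_le_rsqrt)
  moreover have "a / b \<le> 1" if "0 \<le> a" "a \<le> b" for a b :: real
    using that by (cases "b = 0") (auto simp: divide_le_eq_1)
  ultimately have "\<bar>s\<bar> / sqrt (s\<^sup>2 + \<delta>\<^sup>2) \<le> 1" by simp
  then show ?thesis by (simp add: abs_divide)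
qed

lemma norm_pair_le_norm_pair:
  fixes b :: "'b::real_inner" and d :: "'d::real_inner"
  assumes "\<bar>a\<bar> \<le> \<bar>c\<bar>" "norm b \<le> norm d"
  shows "norm (a::real, b) \<le> norm (c::real, d)"
  unfolding norm_Pair using assms by (intro real_sqrt_le_mono add_mono power_mono) auto

lemma energy_space_closed_under_limits:
  assumes "\<And>n. v n \<in> energy_space \<Omega>" "v \<longlonglongrightarrow> w" shows "w \<in> energy_space \<Omega>"
  using closed_sequentially[OF closed_energy_space] assms by blast

text \<open>F is the chain rule for the regularised absolute value, valid classically on jets of
  test functions. It is not Lipschitz in the pair, because a change of slope is multiplied by the
  gradient; so convergence of the jets does not directly give convergence of their images.\<close>

lemma energy_space_smooth_abs:
  assumes f: "sq_integrable f" "abs_l2 f \<in> energy_space \<Omega>" and "\<delta> > 0"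
  defines "F \<equiv> \<lambda>z::real \<times> 'a::euclidean_space. (smooth_abs \<delta> (fst z), (fst z / sqrt ((fst z)\<^sup>2 + \<delta>\<^sup>2)) *\<^sub>R snd z)"
  shows "abs_l2 (\<lambda>x. F (f x)) \<in> energy_space \<Omega>"
proof -
  obtain \<phi> where \<phi>: "\<And>n. test_fun \<Omega> (\<phi> n)" and lim: "(\<lambda>n. abs_l2 (jet (\<phi> n))) \<longlonglongrightarrow> abs_l2 f"
    and ae: "AE x in lebesgue. (\<lambda>n. jet (\<phi> n) x) \<longlonglongrightarrow> f x"
    by (rule energy_space_sequence[OF f]) (rule that)
  let ?j = "\<lambda>n. jet (\<phi> n)"
  \<comment> \<open>The intermediate pair combines the slope at the approximating test function with
    the gradient of the limit. Its distance to the image of the jet is at most |jet - f|, since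
    slopes are bounded by 1, and it tends to the image of f by dominated convergence.\<close>
  define G where "G n x = (smooth_abs \<delta> (fst (f x)), (fst (?j n x) / sqrt ((fst (?j n x))\<^sup>2 + \<delta>\<^sup>2)) *\<^sub>R snd (f x))" for n x
  note sj = sq_integrable_jet[OF \<phi>]
  have [measurable]: "smooth_abs \<delta> \<in> borel_measurable borel"
    unfolding smooth_abs_def by measurable
  have [measurable]: "(\<lambda>x. fst (f x)) \<in> borel_measurable lebesgue" "(\<lambda>x. snd (f x)) \<in> borel_measurable lebesgue"
    "(\<lambda>x. fst (?j n x)) \<in> borel_measurable lebesgue" "(\<lambda>x. snd (?j n x)) \<in> borel_measurable lebesgue" for n
    using sq_integrable_fst[OF f(1)] sq_integrable_snd[OF f(1)] sq_integrable_fst[OF sj] sq_integrable_snd[OF sj]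
    by (auto dest: sq_integrable_measurable)
  have mF: "(\<lambda>x. F (f x)) \<in> borel_measurable lebesgue" unfolding F_def by measurable
  have mG: "G n \<in> borel_measurable lebesgue" for n unfolding G_def by measurable
  have scaled: "norm ((s / sqrt (s\<^sup>2 + \<delta>\<^sup>2)) *\<^sub>R w) \<le> norm w" for s and w :: 'a
    using mult_right_mono[OF abs_divide_sqrt_sum_squares_le[of s \<delta>] norm_ge_zero[of w]] by simp
  have "AE x in lebesgue. (\<lambda>n. G n x) \<longlonglongrightarrow> F (f x)"
    using ae
  proof eventually_elim
    case (elim x)
    then show ?case unfolding G_def F_def
      by (intro tendsto_Pair tendsto_const tendsto_scaleR tendsto_divide tendsto_real_sqrt tendsto_add tendsto_power tendsto_fst)
        (use assms(3) in auto)
  qed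
  moreover have "norm (G n x) \<le> norm (f x)" for n x
    using norm_pair_le_norm_pair[OF abs_smooth_abs_le[OF assms(3)] scaled, of "fst (f x)" _ "snd (f x)"]
    by (simp add: G_def)
  ultimately have G: "(\<lambda>n. abs_l2 (G n)) \<longlonglongrightarrow> abs_l2 (\<lambda>x. F (f x))" "sq_integrable (G n)" for n
    using tendsto_abs_l2_dominated(1,2)[where f = G, OF mG mF f(1)] by simp_all
  have jF: "jet (\<lambda>x. smooth_abs \<delta> (\<phi> n x)) = (\<lambda>x. F (?j n x))" for n
    using test_fun_smooth_abs(2)[OF \<phi> assms(3)] by (simp add: fun_eq_iff jet_def F_def)
  have tF: "test_fun \<Omega> (\<lambda>x. smooth_abs \<delta> (\<phi> n x))" for n using test_fun_smooth_abs(1)[OF \<phi> assms(3)] .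
  then have sF: "sq_integrable (\<lambda>x. F (?j n x))" for n using sq_integrable_jet[OF tF, of n] by (simp add: jF)
  have bound: "norm (abs_l2 (\<lambda>x. F (?j n x)) - abs_l2 (G n)) \<le> norm (abs_l2 (?j n) - abs_l2 f)" for n
  proof -
    have "norm (F (?j n x) - G n x) \<le> norm (?j n x - f x)" for x
    proof -
      have "F (?j n x) - G n x = (smooth_abs \<delta> (fst (?j n x)) - smooth_abs \<delta> (fst (f x)),
          (fst (?j n x) / sqrt ((fst (?j n x))\<^sup>2 + \<delta>\<^sup>2)) *\<^sub>R snd (?j n x - f x))"
        by (simp add: F_def G_def scaleR_diff_right)
      also have "norm \<dots> \<le> norm (fst (?j n x - f x), snd (?j n x - f x))"
        by (intro norm_pair_le_norm_pair scaled) (simp add: smooth_abs_lipschitz)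
      finally show ?thesis by (simp only: prod.collapse)
    qed
    then show ?thesis
      using norm_abs_l2_mono[OF sq_integrable_diff[OF sF[of n] G(2)[of n]] sq_integrable_diff[OF sj[of n] f(1)]]
        sF[of n] G(2)[of n] sj[of n] f(1) by (simp add: minus_l2.abs_eq)
  qed
  have "(\<lambda>n. abs_l2 (\<lambda>x. F (?j n x)) - abs_l2 (G n)) \<longlonglongrightarrow> 0"
    by (rule Lim_null_comparison[OF always_eventually[OF allI, OF bound]])
      (use lim in \<open>simp add: tendsto_norm_zero_iff LIM_zero_iff\<close>)
  from tendsto_add[OF this G(1)] have "(\<lambda>n. abs_l2 (\<lambda>x. F (?j n x))) \<longlonglongrightarrow> abs_l2 (\<lambda>x. F (f x))" by simp
  moreover have "abs_l2 (\<lambda>x. F (?j n x)) \<in> energy_space \<Omega>" for n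
  proof -
    have "abs_l2 (jet (\<lambda>x. smooth_abs \<delta> (\<phi> n x))) \<in> {abs_l2 (jet \<phi>) | \<phi>. test_fun \<Omega> \<phi>}" using tF by blast
    then show ?thesis unfolding energy_space_def jF by (rule subsetD[OF closure_subset])
  qed
  ultimately show ?thesis by (rule energy_space_closed_under_limits[rotated])
qed

text \<open>Limit \<delta> -> 0 with f fixed: the slopes s / sqrt (s^2 + \<delta>^2) tend to sgn s,
  also at s = 0, where each of them is 0, and all pairs stay dominated by f.\<close>

lemma energy_space_abs:
  fixes f :: "'a::euclidean_space \<Rightarrow> real \<times> 'a"
  assumes f: "sq_integrable f" "abs_l2 f \<in> energy_space \<Omega>"
  defines "h \<equiv> \<lambda>x. (\<bar>fst (f x)\<bar>, sgn (fst (f x)) *\<^sub>R snd (f x))"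
  shows "sq_integrable h" "abs_l2 h \<in> energy_space \<Omega>"
proof -
  define \<delta> :: "nat \<Rightarrow> real" where "\<delta> n = inverse (Suc n)" for n
  have pos: "\<delta> n > 0" for n by (simp add: \<delta>_def)
  have \<delta>0: "\<delta> \<longlonglongrightarrow> 0" unfolding \<delta>_def by (rule LIMSEQ_inverse_real_of_nat)
  define F where "F n x = (smooth_abs (\<delta> n) (fst (f x)), (fst (f x) / sqrt ((fst (f x))\<^sup>2 + (\<delta> n)\<^sup>2)) *\<^sub>R snd (f x))" for n x
  have [measurable]: "smooth_abs d \<in> borel_measurable borel" for d
    unfolding smooth_abs_def by measurable
  have [measurable]: "(\<lambda>x. fst (f x)) \<in> borel_measurable lebesgue" "(\<lambda>x. snd (f x)) \<in> borel_measurable lebesgue"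
    using sq_integrable_fst[OF f(1)] sq_integrable_snd[OF f(1)] by (auto dest: sq_integrable_measurable)
  have mF: "F n \<in> borel_measurable lebesgue" for n unfolding F_def by measurable
  have mh: "h \<in> borel_measurable lebesgue" unfolding h_def by measurable
  have "(\<lambda>n. F n x) \<longlonglongrightarrow> h x" for x
  proof -
    define s where "s = fst (f x)"
    have r: "(\<lambda>n. sqrt (s\<^sup>2 + (\<delta> n)\<^sup>2)) \<longlonglongrightarrow> \<bar>s\<bar>"
      using tendsto_real_sqrt[OF tendsto_add[OF tendsto_const tendsto_power[OF \<delta>0, of 2]], of "s\<^sup>2"] by simp
    have "(\<lambda>n. smooth_abs (\<delta> n) s) \<longlonglongrightarrow> \<bar>s\<bar>"
      using tendsto_diff[OF r \<delta>0] by (simp add: smooth_abs_def)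
    moreover have "(\<lambda>n. s / sqrt (s\<^sup>2 + (\<delta> n)\<^sup>2)) \<longlonglongrightarrow> sgn s"
    proof (cases "s = 0")
      case False
      have "(\<lambda>n. s / sqrt (s\<^sup>2 + (\<delta> n)\<^sup>2)) \<longlonglongrightarrow> s / \<bar>s\<bar>"
        using False by (intro tendsto_divide r tendsto_const) simp
      then show ?thesis by (simp add: real_sgn_eq)
    qed simp
    ultimately show ?thesis
      unfolding F_def h_def s_def[symmetric] by (intro tendsto_Pair tendsto_scaleR tendsto_const)
  qed
  moreover have "norm (F n x) \<le> norm (f x)" for n x
  proof -
    have "norm ((s / sqrt (s\<^sup>2 + (\<delta> n)\<^sup>2)) *\<^sub>R w) \<le> norm w" for s and w :: 'a
      using mult_right_mono[OF abs_divide_sqrt_sum_squares_le[of s "\<delta> n"] norm_ge_zero[of w]] by simp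
    from norm_pair_le_norm_pair[OF abs_smooth_abs_le[OF pos] this, of n "fst (f x)" "fst (f x)" "snd (f x)"]
    show ?thesis by (simp add: F_def)
  qed
  ultimately have lim: "(\<lambda>n. abs_l2 (F n)) \<longlonglongrightarrow> abs_l2 h" "sq_integrable h"
    using tendsto_abs_l2_dominated(1,3)[where f = F, OF mF mh f(1)] by simp_all
  show "sq_integrable h" by (rule lim(2))
  have "abs_l2 (F n) \<in> energy_space \<Omega>" for n
    using energy_space_smooth_abs[OF f pos] by (simp add: F_def[abs_def])
  then show "abs_l2 h \<in> energy_space \<Omega>" using lim(1) by (rule energy_space_closed_under_limits)
qed

text \<open>For the pair \<open>(u, \<nabla>u)\<close>, on \<open>{u = 0}\<close> this halves the gradient instead of annihilating it. That is harmless in the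
  comparison argument and avoids proving that weak gradients vanish almost everywhere on \<open>{u = 0}\<close>.\<close>

definition pos_part :: "real \<times> 'a::real_vector \<Rightarrow> real \<times> 'a" where
  "pos_part z = ((fst z + \<bar>fst z\<bar>) / 2, ((1 + sgn (fst z)) / 2) *\<^sub>R snd z)"

lemma energy_space_pos_part:
  fixes f :: "'a::euclidean_space \<Rightarrow> real \<times> 'a"
  assumes f: "sq_integrable f" "abs_l2 f \<in> energy_space \<Omega>"
  shows "sq_integrable (\<lambda>x. pos_part (f x))" "abs_l2 (\<lambda>x. pos_part (f x)) \<in> energy_space \<Omega>"
proof -
  let ?h = "\<lambda>x. (\<bar>fst (f x)\<bar>, sgn (fst (f x)) *\<^sub>R snd (f x))"
  have e: "(\<lambda>x. pos_part (f x)) = (\<lambda>x. (1/2) *\<^sub>R (f x + ?h x))"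
    by (simp add: fun_eq_iff pos_part_def prod_eq_iff scaleR_add_left add_divide_distrib algebra_simps)
  note h = energy_space_abs[OF f]
  show "sq_integrable (\<lambda>x. pos_part (f x))"
    unfolding e by (intro sq_integrable_scaleR sq_integrable_add f h)
  have "(1/2) *\<^sub>R (abs_l2 f + abs_l2 ?h) \<in> energy_space \<Omega>"
    using subspace_energy_space[of \<Omega>] f(2) h(2) by (simp add: subspace_scale subspace_add)
  then show "abs_l2 (\<lambda>x. pos_part (f x)) \<in> energy_space \<Omega>"
    unfolding e using f h by (simp add: plus_l2.abs_eq scaleR_l2.abs_eq sq_integrable_add)
qed

section \<open>Coercivity\<close>

lemma Lmax_coercive:
  fixes lam \<epsilon> L :: real
  assumes "0 \<le> lam" "0 < \<epsilon>" "0 \<le> L" "L < Lmax \<epsilon> lam"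
  shows "\<exists>c>0. \<forall>X\<ge>0. \<forall>Y\<ge>0. lam * Y\<^sup>2 \<le> X\<^sup>2 \<longrightarrow> c * (X\<^sup>2 + Y\<^sup>2) \<le> X\<^sup>2 - L * (X * Y) + (\<epsilon> - lam) * Y\<^sup>2"
proof -
  have "\<exists>c>0. \<forall>X\<ge>0. \<forall>Y\<ge>0. lam * Y\<^sup>2 \<le> X\<^sup>2 \<longrightarrow> c * Y\<^sup>2 \<le> X\<^sup>2 - L * (X * Y) + (\<epsilon> - lam) * Y\<^sup>2"
  proof (cases "\<epsilon> \<le> 2 * lam")
    case True
    define s where "s = sqrt lam"
    have s: "s > 0" "s\<^sup>2 = lam" using True assms by (auto simp: s_def)
    have Ls: "L * s < \<epsilon>" using True assms(4) s(1) by (simp add: Lmax_def s_def[symmetric] field_simps)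
    then have "L * s < 2 * s * s" using True s(2) by (simp add: power2_eq_square)
    \<comment> \<open>The vertex L/2 of the parabola does not exceed the endpoint s, so the minimum
      over X >= s Y is attained at X = s Y.\<close>
    then have L2: "L \<le> 2 * s" using s(1) by simp
    have "(\<epsilon> - L * s) * Y\<^sup>2 \<le> X\<^sup>2 - L * (X * Y) + (\<epsilon> - lam) * Y\<^sup>2"
      if "0 \<le> X" "0 \<le> Y" "lam * Y\<^sup>2 \<le> X\<^sup>2" for X Y
    proof -
      have "(s * Y)\<^sup>2 \<le> X\<^sup>2" using that(3) s(2) by (simp add: power_mult_distrib)
      then have sY: "s * Y \<le> X" using that(1) by (rule power2_le_imp_le)
      moreover have "L * Y \<le> 2 * s * Y" using L2 that(2) by (rule mult_right_mono)
      \<comment> \<open>This product is the excess of the form over its endpoint value (\<epsilon> -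
        L s) Y^2. Both factors are nonnegative by s Y <= X and L <= 2 s.\<close>
      ultimately have "0 \<le> (X - s * Y) * (X + s * Y - L * Y)" by (intro mult_nonneg_nonneg) auto
      then show ?thesis using s(2) by (simp add: algebra_simps power2_eq_square)
    qed
    then show ?thesis using Ls by (intro exI[of _ "\<epsilon> - L * s"]) auto
  next
    case False
    then have "L < 2 * sqrt (\<epsilon> - lam)" using assms(4) by (simp add: Lmax_def)
    then have "L\<^sup>2 < (2 * sqrt (\<epsilon> - lam))\<^sup>2" using assms(3) by (intro power_strict_mono) auto
    then have pos: "0 < \<epsilon> - lam - L\<^sup>2 / 4" using False assms by (simp add: power_mult_distrib)
    \<comment> \<open>Completing the square: the excess over the vertex value is (X - L Y /
      2)^2.\<close>
    have "(\<epsilon> - lam - L\<^sup>2 / 4) * Y\<^sup>2 \<le> X\<^sup>2 - L * (X * Y) + (\<epsilon> - lam) * Y\<^sup>2" for X Y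
      using zero_le_power2[of "X - L / 2 * Y"] by (simp add: algebra_simps power2_eq_square)
    then show ?thesis using pos by blast
  qed
  then obtain c0 where c0: "c0 > 0"
    "\<And>X Y. 0 \<le> X \<Longrightarrow> 0 \<le> Y \<Longrightarrow> lam * Y\<^sup>2 \<le> X\<^sup>2 \<Longrightarrow> c0 * Y\<^sup>2 \<le> X\<^sup>2 - L * (X * Y) + (\<epsilon> - lam) * Y\<^sup>2"
    by blast
  \<comment> \<open>With Q the form, Young's inequality on the mixed term gives X^2/2 - K Y^2 <= Q.
    Adding m times c0 Y^2 <= Q, where m c0 = K + 1/2, leaves (X^2 + Y^2)/2 <= (1 + m) Q, hence the
    final constant 1 / (2 (1 + m)).\<close>
  define K where "K = L\<^sup>2 / 2 + \<bar>\<epsilon> - lam\<bar>"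
  define m where "m = (K + 1/2) / c0"
  have m: "0 \<le> m" "m * c0 = K + 1/2" using c0(1) by (auto simp: m_def K_def)
  have "1 / (2 * (1 + m)) * (X\<^sup>2 + Y\<^sup>2) \<le> X\<^sup>2 - L * (X * Y) + (\<epsilon> - lam) * Y\<^sup>2"
    if XY: "0 \<le> X" "0 \<le> Y" "lam * Y\<^sup>2 \<le> X\<^sup>2" for X Y
  proof -
    define Q where "Q = X\<^sup>2 - L * (X * Y) + (\<epsilon> - lam) * Y\<^sup>2"
    have "m * (c0 * Y\<^sup>2) \<le> m * Q" using c0(2)[OF XY] m(1) unfolding Q_def by (rule mult_left_mono)
    moreover have "m * (c0 * Y\<^sup>2) = (K + 1/2) * Y\<^sup>2" by (simp only: m(2) flip: mult.assoc)
    moreover have "X\<^sup>2 / 2 - K * Y\<^sup>2 \<le> Q"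
    proof -
      have "- (\<bar>\<epsilon> - lam\<bar> * Y\<^sup>2) \<le> (\<epsilon> - lam) * Y\<^sup>2"
        using mult_right_mono[of "- \<bar>\<epsilon> - lam\<bar>" "\<epsilon> - lam" "Y\<^sup>2"] by (simp add: abs_if)
      moreover have "0 \<le> X\<^sup>2 / 2 - L * (X * Y) + L\<^sup>2 / 2 * Y\<^sup>2"
        using zero_le_power2[of "X - L * Y"] by (simp add: algebra_simps power2_eq_square)
      ultimately show ?thesis by (simp add: Q_def K_def algebra_simps)
    qed
    ultimately have "(X\<^sup>2 + Y\<^sup>2) / 2 \<le> (1 + m) * Q" by (simp add: algebra_simps)
    then show ?thesis using m(1) unfolding Q_def[symmetric] by (simp add: field_simps)
  qed
  then show ?thesis using m(1) by (intro exI[of _ "1 / (2 * (1 + m))"]) auto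
qed

text \<open>The witness w of positive norm bounds all admissible constants by its Rayleigh quotient;
  for a set unbounded above, the real \<open>Sup\<close> would be unspecified. The constant 0 is
  admissible, and any other u of positive norm bounds the supremum by its own quotient.\<close>

lemma lambda1_poincare:
  assumes "H10 \<Omega> w k" "0 < (LINT x:\<Omega>|lebesgue. (w x)\<^sup>2)"
  shows "0 \<le> lambda1 \<Omega>"
    and "H10 \<Omega> u g \<Longrightarrow> lambda1 \<Omega> * (LINT x:\<Omega>|lebesgue. (u x)\<^sup>2) \<le> (LINT x:\<Omega>|lebesgue. (norm (g x))\<^sup>2)"
proof -
  define C where "C = {c. \<forall>u g. H10 \<Omega> u g \<longrightarrow>
       c * (LINT x:\<Omega>|lebesgue. (u x)\<^sup>2) \<le> (LINT x:\<Omega>|lebesgue. (norm (g x))\<^sup>2)}"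
  have le: "c \<le> (LINT x:\<Omega>|lebesgue. (norm (g x))\<^sup>2) / (LINT x:\<Omega>|lebesgue. (u x)\<^sup>2)"
    if "c \<in> C" "H10 \<Omega> u g" "0 < (LINT x:\<Omega>|lebesgue. (u x)\<^sup>2)" for c u g
    using that by (simp add: C_def pos_le_divide_eq)
  have nonneg: "0 \<le> (LINT x:\<Omega>|lebesgue. (norm (g x))\<^sup>2)" "0 \<le> (LINT x:\<Omega>|lebesgue. (u x)\<^sup>2)" for u :: "'a \<Rightarrow> real" and g :: "'a \<Rightarrow> 'a"
    by (auto simp: set_lebesgue_integral_def intro!: Bochner_Integration.integral_nonneg)
  have bdd: "bdd_above C" using le[OF _ assms] by (meson bdd_above.I)
  have C0: "0 \<in> C" using nonneg by (simp add: C_def)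
  have lam: "lambda1 \<Omega> = Sup C" by (simp add: lambda1_def C_def)
  show "0 \<le> lambda1 \<Omega>" unfolding lam using C0 bdd by (rule cSup_upper)
  assume u: "H10 \<Omega> u g"
  show "lambda1 \<Omega> * (LINT x:\<Omega>|lebesgue. (u x)\<^sup>2) \<le> (LINT x:\<Omega>|lebesgue. (norm (g x))\<^sup>2)"
  proof (cases "(LINT x:\<Omega>|lebesgue. (u x)\<^sup>2) = 0")
    case False
    then have pos: "0 < (LINT x:\<Omega>|lebesgue. (u x)\<^sup>2)" using nonneg(2)[of u] by simp
    have "lambda1 \<Omega> \<le> (LINT x:\<Omega>|lebesgue. (norm (g x))\<^sup>2) / (LINT x:\<Omega>|lebesgue. (u x)\<^sup>2)"
      unfolding lam using C0 le[OF _ u pos] by (intro cSup_least) auto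
    then show ?thesis using pos by (simp add: pos_le_divide_eq)
  qed (simp add: nonneg)
qed

lemma energy_space_H10:
  assumes "open \<Omega>" "sq_integrable f" "abs_l2 f \<in> energy_space \<Omega>"
  shows "H10 \<Omega> (\<lambda>x. fst (f x)) (\<lambda>x. snd (f x))"
    and "sq_integrable (zero_ext \<Omega> (\<lambda>x. fst (f x)) (\<lambda>x. snd (f x)))"
    and "abs_l2 (zero_ext \<Omega> (\<lambda>x. fst (f x)) (\<lambda>x. snd (f x))) = abs_l2 f"
proof -
  let ?z = "zero_ext \<Omega> (\<lambda>x. fst (f x)) (\<lambda>x. snd (f x))"
  have "?z = (\<lambda>x. indicator \<Omega> x *\<^sub>R f x)"
    by (simp add: fun_eq_iff zero_ext_def prod_eq_iff)
  moreover have "sq_integrable (\<lambda>x. indicator \<Omega> x *\<^sub>R f x)"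
    using assms(1,2) by (intro sq_integrable_mult_bounded borel_measurable_indicator) (auto simp: indicator_def)
  ultimately show z: "sq_integrable ?z" by simp
  show eq: "abs_l2 ?z = abs_l2 f"
    using energy_space_zero_outside[OF assms(2,3)] abs_l2_eq_iff[OF assms(2) z] by simp
  show "H10 \<Omega> (\<lambda>x. fst (f x)) (\<lambda>x. snd (f x))"
    using z eq assms(3) by (simp add: H10_iff_energy_space)
qed

lemma set_integral_energy_space:
  assumes "open \<Omega>" "sq_integrable f" "abs_l2 f \<in> energy_space \<Omega>"
  shows "(LINT x:\<Omega>|lebesgue. (fst (f x))\<^sup>2) = (LINT x|lebesgue. (fst (f x))\<^sup>2)"
    and "(LINT x:\<Omega>|lebesgue. (norm (snd (f x)))\<^sup>2) = (LINT x|lebesgue. (norm (snd (f x)))\<^sup>2)"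
proof -
  note [measurable] = sq_integrable_measurable[OF sq_integrable_fst[OF assms(2)]]
    sq_integrable_measurable[OF sq_integrable_snd[OF assms(2)]]
  have [measurable]: "\<Omega> \<in> sets lebesgue" using assms(1) by simp
  have z: "AE x in lebesgue. x \<notin> \<Omega> \<longrightarrow> fst (f x) = 0 \<and> snd (f x) = 0"
    using energy_space_zero_outside[OF assms(2,3)] by eventually_elim (auto simp: zero_ext_def prod_eq_iff)
  show "(LINT x:\<Omega>|lebesgue. (fst (f x))\<^sup>2) = (LINT x|lebesgue. (fst (f x))\<^sup>2)"
    unfolding set_lebesgue_integral_def using z by (intro integral_cong_AE) (auto simp: indicator_def)
  show "(LINT x:\<Omega>|lebesgue. (norm (snd (f x)))\<^sup>2) = (LINT x|lebesgue. (norm (snd (f x)))\<^sup>2)"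
    unfolding set_lebesgue_integral_def using z by (intro integral_cong_AE) (auto simp: indicator_def)
qed

lemma integral_norm_mult_le:
  assumes "sq_integrable f" "sq_integrable g"
  shows "integrable lebesgue (\<lambda>x. norm (f x) * norm (g x))"
    and "(LINT x|lebesgue. norm (f x) * norm (g x)) \<le> sqrt (LINT x|lebesgue. (norm (f x))\<^sup>2) * sqrt (LINT x|lebesgue. (norm (g x))\<^sup>2)"
proof -
  have n: "sq_integrable (\<lambda>x. norm (f x))" "sq_integrable (\<lambda>x. norm (g x))"
    using assms by (auto simp: sq_integrable_def)
  show "integrable lebesgue (\<lambda>x. norm (f x) * norm (g x))"
    using integrable_inner_sq_integrable[OF n] by simp
  have "(LINT x|lebesgue. norm (f x) * norm (g x)) = abs_l2 (\<lambda>x. norm (f x)) \<bullet> abs_l2 (\<lambda>x. norm (g x))"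
    using n by (simp add: inner_l2.abs_eq)
  also have "\<dots> \<le> norm (abs_l2 (\<lambda>x. norm (f x))) * norm (abs_l2 (\<lambda>x. norm (g x)))"
    by (rule norm_cauchy_schwarz)
  also have "\<dots> = sqrt (LINT x|lebesgue. (norm (f x))\<^sup>2) * sqrt (LINT x|lebesgue. (norm (g x))\<^sup>2)"
    using n by (simp add: norm_eq_sqrt_inner inner_l2.abs_eq power2_eq_square)
  finally show "(LINT x|lebesgue. norm (f x) * norm (g x)) \<le> sqrt (LINT x|lebesgue. (norm (f x))\<^sup>2) * sqrt (LINT x|lebesgue. (norm (g x))\<^sup>2)" .
qed

text \<open>Integrand of the quadratic form. The absolute value takes the gradient term with its
  worst sign, so that the form bounds increments of the operator from below whatever the sign of the
  difference.\<close>

definition energy_form :: "real \<Rightarrow> real \<Rightarrow> real \<times> 'a::euclidean_space \<Rightarrow> real" where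
  "energy_form a L z = (norm (snd z))\<^sup>2 + a * (fst z)\<^sup>2 - L * (norm (snd z) * \<bar>fst z\<bar>)"

lemma energy_form_coercive:
  fixes \<Omega> :: "'a::euclidean_space set"
  assumes "open \<Omega>" "0 < \<epsilon>" "0 \<le> L" "L < Lmax \<epsilon> (lambda1 \<Omega>)"
  shows "\<exists>c>0. \<forall>f. sq_integrable f \<longrightarrow> abs_l2 f \<in> energy_space \<Omega> \<longrightarrow>
     integrable lebesgue (\<lambda>x. energy_form (\<epsilon> - lambda1 \<Omega>) L (f x)) \<and>
     c * (norm (abs_l2 f))\<^sup>2 \<le> (LINT x|lebesgue. energy_form (\<epsilon> - lambda1 \<Omega>) L (f x))"
proof -
  let ?a = "\<epsilon> - lambda1 \<Omega>"
  define X where "X f = sqrt (LINT x|lebesgue. (norm (snd (f x)))\<^sup>2)" for f :: "'a \<Rightarrow> real \<times> 'a"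
  define Y where "Y f = sqrt (LINT x|lebesgue. (fst (f x))\<^sup>2)" for f :: "'a \<Rightarrow> real \<times> 'a"
  have XY0: "0 \<le> X f" "0 \<le> Y f" for f by (auto simp: X_def Y_def)
  have X2: "(X f)\<^sup>2 = (LINT x|lebesgue. (norm (snd (f x)))\<^sup>2)" and Y2: "(Y f)\<^sup>2 = (LINT x|lebesgue. (fst (f x))\<^sup>2)" for f
    by (auto simp: X_def Y_def)
  have main: "integrable lebesgue (\<lambda>x. energy_form ?a L (f x))"
    "(X f)\<^sup>2 - L * (X f * Y f) + ?a * (Y f)\<^sup>2 \<le> (LINT x|lebesgue. energy_form ?a L (f x))"
    "(norm (abs_l2 f))\<^sup>2 = (X f)\<^sup>2 + (Y f)\<^sup>2" if f: "sq_integrable f" for f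
  proof -
    note i1 = sq_integrable_norm_sq[OF sq_integrable_snd[OF f]]
    have i2: "integrable lebesgue (\<lambda>x. (fst (f x))\<^sup>2)" using sq_integrable_norm_sq[OF sq_integrable_fst[OF f]] by simp
    have i3: "integrable lebesgue (\<lambda>x. norm (snd (f x)) * \<bar>fst (f x)\<bar>)"
      "(LINT x|lebesgue. norm (snd (f x)) * \<bar>fst (f x)\<bar>) \<le> X f * Y f"
      using integral_norm_mult_le[OF sq_integrable_snd[OF f] sq_integrable_fst[OF f]] by (simp_all add: X_def Y_def)
    show "integrable lebesgue (\<lambda>x. energy_form ?a L (f x))" unfolding energy_form_def using i1 i2 i3 by auto
    have "(LINT x|lebesgue. energy_form ?a L (f x)) = (X f)\<^sup>2 + ?a * (Y f)\<^sup>2 - L * (LINT x|lebesgue. norm (snd (f x)) * \<bar>fst (f x)\<bar>)"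
      unfolding energy_form_def X2 Y2 using i1 i2 i3(1) by simp
    then show "(X f)\<^sup>2 - L * (X f * Y f) + ?a * (Y f)\<^sup>2 \<le> (LINT x|lebesgue. energy_form ?a L (f x))"
      using mult_left_mono[OF i3(2) assms(3)] by linarith
    have "(norm (abs_l2 f))\<^sup>2 = (LINT x|lebesgue. (fst (f x))\<^sup>2 + (norm (snd (f x)))\<^sup>2)"
      unfolding power2_norm_l2_abs[OF f] by (simp add: norm_prod_def)
    then show "(norm (abs_l2 f))\<^sup>2 = (X f)\<^sup>2 + (Y f)\<^sup>2" using i1 i2 by (simp add: X2 Y2)
  qed
  show ?thesis
  proof (cases "\<exists>w k. H10 \<Omega> w k \<and> 0 < (LINT x:\<Omega>|lebesgue. (w x)\<^sup>2)")
    case True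
    then obtain w k where wk: "H10 \<Omega> w k" "0 < (LINT x:\<Omega>|lebesgue. (w x)\<^sup>2)" by blast
    obtain c where c: "c > 0" "\<And>X Y. 0 \<le> X \<Longrightarrow> 0 \<le> Y \<Longrightarrow> lambda1 \<Omega> * Y\<^sup>2 \<le> X\<^sup>2 \<Longrightarrow>
        c * (X\<^sup>2 + Y\<^sup>2) \<le> X\<^sup>2 - L * (X * Y) + ?a * Y\<^sup>2"
      using Lmax_coercive[OF lambda1_poincare(1)[OF wk] assms(2-4)] by blast
    have "c * (norm (abs_l2 f))\<^sup>2 \<le> (LINT x|lebesgue. energy_form ?a L (f x))"
      if f: "sq_integrable f" "abs_l2 f \<in> energy_space \<Omega>" for f
    proof -
      have "lambda1 \<Omega> * (Y f)\<^sup>2 \<le> (X f)\<^sup>2"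
        using lambda1_poincare(2)[OF wk energy_space_H10(1)[OF assms(1) f]]
        by (simp add: X2 Y2 set_integral_energy_space[OF assms(1) f])
      then show ?thesis using c(2)[OF XY0] main[OF f(1)] by force
    qed
    then show ?thesis using c(1) main(1) by blast
  next
    \<comment> \<open>Then \<open>lambda1\<close> is the supremum of an unbounded set, an unspecified number, but it is only ever
      multiplied by zero.\<close>
    case False
    have "1 * (norm (abs_l2 f))\<^sup>2 \<le> (LINT x|lebesgue. energy_form ?a L (f x))"
      if f: "sq_integrable f" "abs_l2 f \<in> energy_space \<Omega>" for f
    proof -
      have "(LINT x:\<Omega>|lebesgue. (fst (f x))\<^sup>2) \<le> 0"
        using False energy_space_H10(1)[OF assms(1) f] by (meson not_le)
      then have "Y f = 0" using XY0(2)[of f] Y2[of f] set_integral_energy_space(1)[OF assms(1) f]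
        by (metis Y_def order_antisym real_sqrt_le_0_iff)
      then show ?thesis using main[OF f(1)] by simp
    qed
    then show ?thesis using main(1) zero_less_one by blast
  qed
qed

section \<open>The operator of problem (D1)\<close>

text \<open>Continuity of the inner product carries orthogonality from the jets to their closure; a
  weak formulation with smooth test functions is thus a statement about all of H^1_0.\<close>

lemma orthogonal_energy_space_iff:
  assumes "sq_integrable F"
  shows "(\<forall>s\<in>energy_space \<Omega>. abs_l2 F \<bullet> s = 0) \<longleftrightarrow>
    (\<forall>\<phi>. test_fun \<Omega> \<phi> \<longrightarrow> (LINT x|lebesgue. F x \<bullet> jet \<phi> x) = 0)"
proof -
  have inner: "abs_l2 F \<bullet> abs_l2 (jet \<phi>) = (LINT x|lebesgue. F x \<bullet> jet \<phi> x)" if "test_fun \<Omega> \<phi>" for \<phi>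
    using assms sq_integrable_jet[OF that] by (simp add: inner_l2.abs_eq)
  let ?J = "{abs_l2 (jet \<phi>) | \<phi>. test_fun \<Omega> \<phi>}"
  have "closed {s. abs_l2 F \<bullet> s = 0}"
    by (intro closed_Collect_eq continuous_on_inner continuous_on_const continuous_on_id)
  then have "(\<forall>s\<in>energy_space \<Omega>. abs_l2 F \<bullet> s = 0) \<longleftrightarrow> ?J \<subseteq> {s. abs_l2 F \<bullet> s = 0}"
    unfolding energy_space_def using closure_minimal[of ?J "{s. abs_l2 F \<bullet> s = 0}"] closure_subset[of ?J] by blast
  also have "\<dots> \<longleftrightarrow> (\<forall>\<phi>. test_fun \<Omega> \<phi> \<longrightarrow> (LINT x|lebesgue. F x \<bullet> jet \<phi> x) = 0)"
    using inner by auto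
  finally show ?thesis .
qed

text \<open>This admits nonsmooth test functions such as positive parts: the weak equation says that
  (-r, k) is orthogonal to all jets, hence to the whole energy space.\<close>

lemma weak_form_energy_space:
  fixes r :: "'a::euclidean_space \<Rightarrow> real" and k :: "'a \<Rightarrow> 'a"
  assumes r: "sq_integrable r" and k: "sq_integrable k"
    and weak: "\<And>\<phi>. test_fun \<Omega> \<phi> \<Longrightarrow> (LINT x|lebesgue. k x \<bullet> grad \<phi> x) = (LINT x|lebesgue. r x * \<phi> x)"
    and p: "sq_integrable p" "abs_l2 p \<in> energy_space \<Omega>"
  shows "(LINT x|lebesgue. k x \<bullet> snd (p x)) = (LINT x|lebesgue. r x * fst (p x))"
proof -
  define F where "F x = (- r x, k x)" for x
  have F: "sq_integrable F" unfolding F_def using sq_integrable_Pair[OF sq_integrable_uminus[OF r] k] .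
  have split: "(LINT x|lebesgue. F x \<bullet> q x) = (LINT x|lebesgue. k x \<bullet> snd (q x)) - (LINT x|lebesgue. r x * fst (q x))"
    if q: "sq_integrable q" for q
  proof -
    have "integrable lebesgue (\<lambda>x. k x \<bullet> snd (q x))" "integrable lebesgue (\<lambda>x. r x * fst (q x))"
      using integrable_inner_sq_integrable[OF k sq_integrable_snd[OF q]]
        integrable_inner_sq_integrable[OF r sq_integrable_fst[OF q]] by simp_all
    then show ?thesis by (simp add: F_def inner_prod_def)
  qed
  have "\<forall>s\<in>energy_space \<Omega>. abs_l2 F \<bullet> s = 0"
    unfolding orthogonal_energy_space_iff[OF F] using weak split[OF sq_integrable_jet] by (simp add: jet_def)
  then have "abs_l2 F \<bullet> abs_l2 p = 0" using p(2) by blast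
  then show ?thesis using F p(1) split[OF p(1)] by (simp add: inner_l2.abs_eq)
qed

definition D1_operator :: "real \<Rightarrow> real \<Rightarrow> ('a::euclidean_space \<Rightarrow> real) \<Rightarrow> ('a \<Rightarrow> real \<times> 'a) \<Rightarrow> 'a \<Rightarrow> real \<times> 'a" where
  "D1_operator a L h f x = (a * fst (f x) - L * norm (snd (f x)) - h x, snd (f x))"

lemma sq_integrable_D1_operator:
  assumes "sq_integrable f" "sq_integrable h" shows "sq_integrable (D1_operator a L h f)"
proof -
  have n: "sq_integrable (\<lambda>x. norm (snd (f x)))"
    using sq_integrable_snd[OF assms(1)] by (auto simp: sq_integrable_def)
  show ?thesis unfolding D1_operator_def[abs_def]
    using sq_integrable_scaleR[OF n, of L] sq_integrable_scaleR[OF sq_integrable_fst[OF assms(1)], of a]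
    by (intro sq_integrable_Pair sq_integrable_snd sq_integrable_diff assms) simp_all
qed

lemma weak_sol_D1_iff:
  fixes h :: "'a::euclidean_space \<Rightarrow> real"
  assumes "L2 \<Omega> h"
  shows "weak_sol_D1 \<Omega> \<epsilon> L h v \<longleftrightarrow> (\<exists>g. H10 \<Omega> v g \<and> (\<forall>s\<in>energy_space \<Omega>.
    abs_l2 (D1_operator (\<epsilon> - lambda1 \<Omega>) L (\<lambda>x. indicator \<Omega> x * h x) (zero_ext \<Omega> v g)) \<bullet> s = 0))"
proof -
  let ?a = "\<epsilon> - lambda1 \<Omega>" and ?h = "\<lambda>x. indicator \<Omega> x * h x"
  have h: "sq_integrable ?h" using assms by (simp add: L2_iff_sq_integrable)
  have "(\<forall>\<phi>. test_fun \<Omega> \<phi> \<longrightarrow>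
        (LINT x:\<Omega>|lebesgue. g x \<bullet> grad \<phi> x) =
        (LINT x:\<Omega>|lebesgue. ((lambda1 \<Omega> - \<epsilon>) * v x + L * norm (g x) + h x) * \<phi> x)) \<longleftrightarrow>
     (\<forall>s\<in>energy_space \<Omega>. abs_l2 (D1_operator ?a L ?h (zero_ext \<Omega> v g)) \<bullet> s = 0)" if "H10 \<Omega> v g" for g
  proof -
    let ?z = "zero_ext \<Omega> v g"
    have z: "sq_integrable ?z" using that by (simp add: H10_iff_energy_space)
    note N = sq_integrable_D1_operator[OF z h, of ?a L]
    have "(LINT x|lebesgue. D1_operator ?a L ?h ?z x \<bullet> jet \<phi> x) = (LINT x:\<Omega>|lebesgue. g x \<bullet> grad \<phi> x) -
        (LINT x:\<Omega>|lebesgue. ((lambda1 \<Omega> - \<epsilon>) * v x + L * norm (g x) + h x) * \<phi> x)" if "test_fun \<Omega> \<phi>" for \<phi>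
    proof -
      have j: "sq_integrable (jet \<phi>)" using that by (rule sq_integrable_jet)
      have e1: "indicator \<Omega> x *\<^sub>R (g x \<bullet> grad \<phi> x) = snd (D1_operator ?a L ?h ?z x) \<bullet> snd (jet \<phi> x)"
        and e2: "indicator \<Omega> x *\<^sub>R (((lambda1 \<Omega> - \<epsilon>) * v x + L * norm (g x) + h x) * \<phi> x)
          = - (fst (D1_operator ?a L ?h ?z x) \<bullet> fst (jet \<phi> x))" for x
        by (auto simp: D1_operator_def zero_ext_def jet_def indicator_def algebra_simps)
      show ?thesis
        unfolding set_lebesgue_integral_def e1 e2 inner_prod_def
        using integrable_inner_sq_integrable[OF sq_integrable_fst[OF N] sq_integrable_fst[OF j]]
          integrable_inner_sq_integrable[OF sq_integrable_snd[OF N] sq_integrable_snd[OF j]] by simp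
    qed
    then show ?thesis unfolding orthogonal_energy_space_iff[OF N] by auto
  qed
  then show ?thesis unfolding weak_sol_D1_def by blast
qed

text \<open>The term h cancels in the difference. The reverse triangle inequality bounds the
  difference of the gradient norms by the norm of the gradient difference, which is exactly the term
  in \<open>energy_form\<close>.\<close>

lemma D1_operator_monotone:
  assumes "0 \<le> L"
  shows "energy_form a L (f x - p x) \<le> (D1_operator a L h f x - D1_operator a L h p x) \<bullet> (f x - p x)"
proof -
  define y where "y = fst (f x) - fst (p x)"
  define d where "d = snd (f x) - snd (p x)"
  have "\<bar>norm (snd (f x)) - norm (snd (p x))\<bar> \<le> norm d" unfolding d_def by (rule norm_triangle_ineq3)
  then have "\<bar>norm (snd (f x)) - norm (snd (p x))\<bar> * \<bar>y\<bar> \<le> norm d * \<bar>y\<bar>" by (rule mult_right_mono) simp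
  then have "(norm (snd (f x)) - norm (snd (p x))) * y \<le> norm d * \<bar>y\<bar>"
    by (metis abs_le_D1 abs_mult)
  then have "L * ((norm (snd (f x)) - norm (snd (p x))) * y) \<le> L * (norm d * \<bar>y\<bar>)"
    using assms by (rule mult_left_mono)
  moreover have "(D1_operator a L h f x - D1_operator a L h p x) \<bullet> (f x - p x)
      = (norm d)\<^sup>2 + a * y\<^sup>2 - L * ((norm (snd (f x)) - norm (snd (p x))) * y)"
    unfolding power2_norm_eq_inner
    by (simp add: D1_operator_def inner_prod_def y_def d_def algebra_simps power2_eq_square)
  ultimately show ?thesis by (simp add: energy_form_def y_def d_def)
qed

lemma D1_operator_pos_part:
  assumes "0 \<le> L"
  shows "energy_form a L (pos_part (f x - p x)) \<le>
    (D1_operator a L h f x - D1_operator a L h p x) \<bullet> pos_part (f x - p x)"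
proof (cases "fst (f x - p x)" "0::real" rule: linorder_cases)
  case less
  then show ?thesis by (simp add: pos_part_def energy_form_def inner_prod_def)
next
  \<comment> \<open>With d the gradient difference, the halved gradient gives |d|^2/4 on the left
    and |d|^2/2 on the right, so the inequality survives the unusual value on the zero set.\<close>
  case equal
  then have "pos_part (f x - p x) = (0, (1/2) *\<^sub>R snd (f x - p x))" by (simp add: pos_part_def)
  then show ?thesis
    by (simp add: energy_form_def inner_prod_def D1_operator_def power2_norm_eq_inner power_divide
        flip: power2_norm_eq_inner)
next
  case greater
  then have "pos_part (f x - p x) = f x - p x" by (simp add: pos_part_def prod_eq_iff)
  then show ?thesis using D1_operator_monotone[OF assms] by simp
qed

lemma D1_operator_lipschitz:
  assumes "0 \<le> L"
  shows "norm (D1_operator a L h f x - D1_operator a L h p x) \<le> (\<bar>a\<bar> + L + 1) * norm (f x - p x)"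
proof -
  let ?n = "norm (f x - p x)"
  have fs: "\<bar>fst (f x - p x)\<bar> \<le> ?n" "norm (snd (f x - p x)) \<le> ?n"
    by (metis norm_fst_le prod.collapse real_norm_def) (metis norm_snd_le prod.collapse)
  have "\<bar>a * fst (f x - p x)\<bar> \<le> \<bar>a\<bar> * ?n" using fs(1) by (simp only: abs_mult) (intro mult_left_mono, auto)
  moreover have "\<bar>L * (norm (snd (f x)) - norm (snd (p x)))\<bar> \<le> L * ?n"
    unfolding abs_mult using assms fs(2) norm_triangle_ineq3[of "snd (f x)" "snd (p x)"]
    by (intro mult_mono) auto
  moreover have "norm (D1_operator a L h f x - D1_operator a L h p x) \<le>
      \<bar>a * fst (f x - p x) - L * (norm (snd (f x)) - norm (snd (p x)))\<bar> + norm (snd (f x - p x))"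
    using norm_Pair_le[of "a * fst (f x - p x) - L * (norm (snd (f x)) - norm (snd (p x)))" "snd (f x - p x)"]
    by (simp add: D1_operator_def algebra_simps)
  ultimately show ?thesis using fs(2) by (simp add: algebra_simps)
qed

lemma D1_operator_cong_AE:
  assumes "sq_integrable f" "sq_integrable p" "sq_integrable h" "abs_l2 f = abs_l2 p"
  shows "abs_l2 (D1_operator a L h f) = abs_l2 (D1_operator a L h p)"
proof -
  have "AE x in lebesgue. f x = p x" using assms by (simp add: abs_l2_eq_iff)
  then have "AE x in lebesgue. D1_operator a L h f x = D1_operator a L h p x"
    by eventually_elim (simp add: D1_operator_def)
  then show ?thesis using assms by (simp add: abs_l2_eq_iff sq_integrable_D1_operator)
qed

lemma rep_l2: "sq_integrable (rep_l2 v)" "abs_l2 (rep_l2 v) = v"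
  using Quotient3_rep_reflp[OF Quotient3_l2, of v] Quotient3_abs_rep[OF Quotient3_l2, of v] by auto

section \<open>Existence and the comparison principle for (D1)\<close>

lemma D1_solution_exists:
  fixes \<Omega> :: "'a::euclidean_space set"
  assumes "open \<Omega>" "0 < \<epsilon>" "0 \<le> L" "L < Lmax \<epsilon> (lambda1 \<Omega>)" "L2 \<Omega> h"
  shows "\<exists>v. weak_sol_D1 \<Omega> \<epsilon> L h v"
proof -
  let ?a = "\<epsilon> - lambda1 \<Omega>"
  obtain c where c: "c > 0" "\<And>f. sq_integrable f \<Longrightarrow> abs_l2 f \<in> energy_space \<Omega> \<Longrightarrow>
     integrable lebesgue (\<lambda>x. energy_form ?a L (f x)) \<and>
     c * (norm (abs_l2 f))\<^sup>2 \<le> (LINT x|lebesgue. energy_form ?a L (f x))"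
    using energy_form_coercive[OF assms(1-4)] by blast
  define H where "H x = indicator \<Omega> x * h x" for x
  have H: "sq_integrable H" using assms(5) by (simp add: L2_iff_sq_integrable H_def[abs_def])
  define N where "N f = D1_operator ?a L H f" for f
  have sN: "sq_integrable (N f)" if "sq_integrable f" for f
    using sq_integrable_D1_operator[OF that H] by (simp add: N_def)
  \<comment> \<open>The operator acts on functions and not on classes, so it is applied to the
    representative \<open>rep_l2 w\<close>; its class does not depend on this choice, by
    \<open>D1_operator_cong_AE\<close>.\<close>
  have "\<exists>w\<in>energy_space \<Omega>. \<forall>s\<in>energy_space \<Omega>. abs_l2 (N (rep_l2 w)) \<bullet> s = 0"
  proof (rule strongly_monotone_equation_solvable[OF subspace_energy_space closed_energy_space c(1)])
    fix v w assume vw: "v \<in> energy_space \<Omega>" "w \<in> energy_space \<Omega>"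
    define f where "f = rep_l2 v"
    define p where "p = rep_l2 w"
    have f: "sq_integrable f" "abs_l2 f = v" and p: "sq_integrable p" "abs_l2 p = w"
      by (simp_all add: f_def p_def rep_l2)
    have d: "sq_integrable (\<lambda>x. f x - p x)" and Nd: "sq_integrable (\<lambda>x. N f x - N p x)"
      using f(1) p(1) by (simp_all add: sq_integrable_diff sN)
    have vw_eq: "v - w = abs_l2 (\<lambda>x. f x - p x)" using f p by (auto simp: minus_l2.abs_eq)
    have N_eq: "abs_l2 (N f) - abs_l2 (N p) = abs_l2 (\<lambda>x. N f x - N p x)"
      using sN[OF f(1)] sN[OF p(1)] by (simp add: minus_l2.abs_eq)
    have dE: "abs_l2 (\<lambda>x. f x - p x) \<in> energy_space \<Omega>"
      using vw subspace_energy_space[of \<Omega>] by (simp flip: vw_eq add: subspace_diff)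
    have "c * (norm (v - w))\<^sup>2 \<le> (LINT x|lebesgue. energy_form ?a L (f x - p x))"
      unfolding vw_eq using c(2)[OF d dE] by simp
    also have "\<dots> \<le> (LINT x|lebesgue. (N f x - N p x) \<bullet> (f x - p x))"
      unfolding N_def
      by (intro integral_mono D1_operator_monotone assms(3) conjunct1[OF c(2)[OF d dE]]
          integrable_inner_sq_integrable d Nd[unfolded N_def])
    also have "\<dots> = (abs_l2 (N f) - abs_l2 (N p)) \<bullet> (v - w)"
      unfolding N_eq vw_eq using d Nd by (simp add: inner_l2.abs_eq)
    finally show "c * (norm (v - w))\<^sup>2 \<le> (abs_l2 (N (rep_l2 v)) - abs_l2 (N (rep_l2 w))) \<bullet> (v - w)"
      by (simp add: f_def p_def)
    let ?M = "\<bar>?a\<bar> + L + 1"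
    have "norm (abs_l2 (\<lambda>x. N f x - N p x)) \<le> norm (abs_l2 (\<lambda>x. ?M *\<^sub>R (f x - p x)))"
    proof (rule norm_abs_l2_mono[OF Nd sq_integrable_scaleR[OF d]])
      show "AE x in lebesgue. norm (N f x - N p x) \<le> norm (?M *\<^sub>R (f x - p x))"
        using D1_operator_lipschitz[OF assms(3), of ?a H f _ p] assms(3) by (auto simp: N_def)
    qed
    also have "\<dots> = ?M * norm (v - w)"
      unfolding vw_eq using scaleR_l2.abs_eq[of "\<lambda>x. f x - p x" ?M] d assms(3) by (simp flip: scaleR_l2.abs_eq)
    finally show "norm (abs_l2 (N (rep_l2 v)) - abs_l2 (N (rep_l2 w))) \<le> ?M * norm (v - w)"
      by (simp add: N_eq flip: f_def p_def)
  qed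
  then obtain w where w: "w \<in> energy_space \<Omega>" "\<And>s. s \<in> energy_space \<Omega> \<Longrightarrow> abs_l2 (N (rep_l2 w)) \<bullet> s = 0" by blast
  define f where "f = rep_l2 w"
  have f: "sq_integrable f" "abs_l2 f \<in> energy_space \<Omega>" using w(1) by (simp_all add: f_def rep_l2)
  note e = energy_space_H10[OF assms(1) f]
  \<comment> \<open>Cutting the representative off outside \<Omega> changes it only on a null set,
    so the equation carries over to the function that (D1) is about.\<close>
  have "abs_l2 (N (zero_ext \<Omega> (\<lambda>x. fst (f x)) (\<lambda>x. snd (f x)))) = abs_l2 (N f)"
    unfolding N_def by (rule D1_operator_cong_AE[OF e(2) f(1) H e(3)])
  then have "\<forall>s\<in>energy_space \<Omega>. abs_l2 (N (zero_ext \<Omega> (\<lambda>x. fst (f x)) (\<lambda>x. snd (f x)))) \<bullet> s = 0"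
    using w(2) by (simp add: f_def)
  then show ?thesis
    using e(1) unfolding weak_sol_D1_iff[OF assms(5)] N_def H_def[abs_def] by blast
qed

text \<open>Hypothesis \<open>sub\<close> is the subsolution inequality restricted to what k = (u -
  v)^+ requires: tests whose function part is nonnegative and positive only where v < u. Coercivity
  bounds c |k|^2 by the energy of k, and the operator inequality bounds this by the inner product of
  N f - N p with k. The p part is 0 because v is a solution, so k = 0.\<close>

lemma D1_comparison:
  fixes \<Omega> :: "'a::euclidean_space set"
  assumes "open \<Omega>" "0 < \<epsilon>" "0 \<le> L" "L < Lmax \<epsilon> (lambda1 \<Omega>)" "L2 \<Omega> h"
    and v: "weak_sol_D1 \<Omega> \<epsilon> L h v" and u: "H10 \<Omega> u g"
    and sub: "\<And>k. sq_integrable k \<Longrightarrow> abs_l2 k \<in> energy_space \<Omega> \<Longrightarrow> (\<And>x. 0 \<le> fst (k x)) \<Longrightarrow>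
        (\<And>x. 0 < fst (k x) \<Longrightarrow> x \<in> \<Omega> \<and> v x < u x) \<Longrightarrow>
        (LINT x|lebesgue. D1_operator (\<epsilon> - lambda1 \<Omega>) L (\<lambda>x. indicator \<Omega> x * h x) (zero_ext \<Omega> u g) x \<bullet> k x) \<le> 0"
  shows "AE x in lebesgue. x \<in> \<Omega> \<longrightarrow> u x \<le> v x"
proof -
  let ?a = "\<epsilon> - lambda1 \<Omega>"
  obtain c where c: "c > 0" "\<And>f. sq_integrable f \<Longrightarrow> abs_l2 f \<in> energy_space \<Omega> \<Longrightarrow>
     integrable lebesgue (\<lambda>x. energy_form ?a L (f x)) \<and>
     c * (norm (abs_l2 f))\<^sup>2 \<le> (LINT x|lebesgue. energy_form ?a L (f x))"
    using energy_form_coercive[OF assms(1-4)] by blast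
  define N where "N f = D1_operator ?a L (\<lambda>x. indicator \<Omega> x * h x) f" for f
  have sN: "sq_integrable (N f)" if "sq_integrable f" for f
    using sq_integrable_D1_operator[OF that] assms(5) by (simp add: N_def L2_iff_sq_integrable)
  obtain gv where gv: "H10 \<Omega> v gv" "\<And>s. s \<in> energy_space \<Omega> \<Longrightarrow> abs_l2 (N (zero_ext \<Omega> v gv)) \<bullet> s = 0"
    using v unfolding weak_sol_D1_iff[OF assms(5)] N_def by blast
  define f where "f = zero_ext \<Omega> u g"
  define p where "p = zero_ext \<Omega> v gv"
  have f: "sq_integrable f" "abs_l2 f \<in> energy_space \<Omega>" and p: "sq_integrable p" "abs_l2 p \<in> energy_space \<Omega>"
    using u gv(1) by (simp_all add: f_def p_def H10_iff_energy_space)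
  define k where "k x = pos_part (f x - p x)" for x
  have d: "sq_integrable (\<lambda>x. f x - p x)" using f(1) p(1) by (rule sq_integrable_diff)
  have "abs_l2 f - abs_l2 p \<in> energy_space \<Omega>" using subspace_energy_space f(2) p(2) by (rule subspace_diff)
  then have "abs_l2 (\<lambda>x. f x - p x) \<in> energy_space \<Omega>" using f(1) p(1) by (simp add: minus_l2.abs_eq)
  from energy_space_pos_part[OF d this] have k: "sq_integrable k" "abs_l2 k \<in> energy_space \<Omega>"
    by (simp_all add: k_def[abs_def])
  have k_sign: "0 \<le> fst (k x)" "0 < fst (k x) \<Longrightarrow> x \<in> \<Omega> \<and> v x < u x" for x
    by (cases "x \<in> \<Omega>"; auto simp: k_def pos_part_def f_def p_def zero_ext_def)+
  have "c * (norm (abs_l2 k))\<^sup>2 \<le> (LINT x|lebesgue. energy_form ?a L (k x))" using c(2)[OF k] by simp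
  also have "\<dots> \<le> (LINT x|lebesgue. (N f x - N p x) \<bullet> k x)"
    unfolding N_def k_def
    by (intro integral_mono D1_operator_pos_part assms(3) conjunct1[OF c(2)[OF k, unfolded k_def]]
        integrable_inner_sq_integrable sq_integrable_diff sN[unfolded N_def] f(1) p(1) k(1)[unfolded k_def[abs_def]])
  also have "\<dots> = (LINT x|lebesgue. N f x \<bullet> k x) - (LINT x|lebesgue. N p x \<bullet> k x)"
    using integrable_inner_sq_integrable[OF sN k(1)] f(1) p(1) by (simp add: inner_diff_left)
  also have "(LINT x|lebesgue. N p x \<bullet> k x) = 0"
    using gv(2)[OF k(2)] sN[OF p(1)] k(1) by (simp add: inner_l2.abs_eq flip: p_def)
  also have "(LINT x|lebesgue. N f x \<bullet> k x) - 0 \<le> 0"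
    using sub[OF k k_sign] by (simp add: N_def f_def)
  finally have "abs_l2 k = 0" using c(1) by (simp add: mult_le_0_iff)
  then have "AE x in lebesgue. k x = 0"
    using abs_l2_eq_iff[OF k(1) sq_integrable_zero] by (simp add: zero_l2.abs_eq zero_l2_def)
  then show ?thesis
    by eventually_elim (auto simp: k_def pos_part_def f_def p_def zero_ext_def prod_eq_iff)
qed

section \<open>Comparison and the main result\<close>

lemma H10_uminus:
  assumes "H10 \<Omega> u g" shows "H10 \<Omega> (\<lambda>x. - u x) (\<lambda>x. - g x)"
proof -
  have "zero_ext \<Omega> (\<lambda>x. - u x) (\<lambda>x. - g x) = (\<lambda>x. - zero_ext \<Omega> u g x)"
    by (simp add: fun_eq_iff zero_ext_def)
  then show ?thesis
    using assms subspace_neg[OF subspace_energy_space, of "abs_l2 (zero_ext \<Omega> u g)" \<Omega>]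
    by (simp add: H10_iff_energy_space sq_integrable_uminus uminus_l2.abs_eq)
qed

lemma H10_zero: "H10 \<Omega> (\<lambda>x. 0) (\<lambda>x. 0)"
proof -
  have "zero_ext \<Omega> (\<lambda>x. 0) (\<lambda>x. 0) = (\<lambda>x::'a. 0)"
    by (simp add: fun_eq_iff zero_ext_def zero_prod_def)
  then show ?thesis
    using subspace_0[OF subspace_energy_space, of \<Omega>]
    by (simp add: H10_iff_energy_space sq_integrable_zero zero_l2_def)
qed

lemma weak_sol_D0_iff_D1: "weak_sol_D0 \<Omega> \<epsilon> L h v \<longleftrightarrow> weak_sol_D1 \<Omega> \<epsilon> L h (\<lambda>x. - v x)"
proof -
  have lhs: "(LINT x:\<Omega>|lebesgue. (- g x) \<bullet> grad \<phi> x) = - (LINT x:\<Omega>|lebesgue. g x \<bullet> grad \<phi> x)" for g \<phi>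
    by (simp add: set_lebesgue_integral_def)
  have rhs: "(LINT x:\<Omega>|lebesgue. ((lambda1 \<Omega> - \<epsilon>) * (- v x) + L * norm (- g x) + h x) * \<phi> x) =
      - (LINT x:\<Omega>|lebesgue. ((lambda1 \<Omega> - \<epsilon>) * v x - L * norm (g x) - h x) * \<phi> x)" for g \<phi>
    unfolding set_lebesgue_integral_def
    by (subst Bochner_Integration.integral_minus[symmetric])
      (auto intro!: Bochner_Integration.integral_cong simp: algebra_simps)
  have eq: "(LINT x:\<Omega>|lebesgue. (- g x) \<bullet> grad \<phi> x) =
        (LINT x:\<Omega>|lebesgue. ((lambda1 \<Omega> - \<epsilon>) * (- v x) + L * norm (- g x) + h x) * \<phi> x) \<longleftrightarrow>
      (LINT x:\<Omega>|lebesgue. g x \<bullet> grad \<phi> x) =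
        (LINT x:\<Omega>|lebesgue. ((lambda1 \<Omega> - \<epsilon>) * v x - L * norm (g x) - h x) * \<phi> x)" for g \<phi>
    unfolding lhs rhs by simp
  show ?thesis
  proof
    assume "weak_sol_D0 \<Omega> \<epsilon> L h v"
    then obtain g where g: "H10 \<Omega> v g" "\<forall>\<phi>. test_fun \<Omega> \<phi> \<longrightarrow> (LINT x:\<Omega>|lebesgue. g x \<bullet> grad \<phi> x) =
        (LINT x:\<Omega>|lebesgue. ((lambda1 \<Omega> - \<epsilon>) * v x - L * norm (g x) - h x) * \<phi> x)"
      unfolding weak_sol_D0_def by blast
    then show "weak_sol_D1 \<Omega> \<epsilon> L h (\<lambda>x. - v x)"
      unfolding weak_sol_D1_def by (intro exI[of _ "\<lambda>x. - g x"]) (simp only: eq H10_uminus simp_thms)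
  next
    assume "weak_sol_D1 \<Omega> \<epsilon> L h (\<lambda>x. - v x)"
    then obtain g where g: "H10 \<Omega> (\<lambda>x. - v x) g" "\<forall>\<phi>. test_fun \<Omega> \<phi> \<longrightarrow> (LINT x:\<Omega>|lebesgue. g x \<bullet> grad \<phi> x) =
        (LINT x:\<Omega>|lebesgue. ((lambda1 \<Omega> - \<epsilon>) * (- v x) + L * norm (g x) + h x) * \<phi> x)"
      unfolding weak_sol_D1_def by blast
    have "H10 \<Omega> v (\<lambda>x. - g x)" using H10_uminus[OF g(1)] by simp
    then show "weak_sol_D0 \<Omega> \<epsilon> L h v"
      unfolding weak_sol_D0_def using g(2) eq[of "\<lambda>x. - g x"] by (intro exI[of _ "\<lambda>x. - g x"]) simp
  qed
qed

lemma D1_solution_unique: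
  assumes "open \<Omega>" "0 < \<epsilon>" "0 \<le> L" "L < Lmax \<epsilon> (lambda1 \<Omega>)" "L2 \<Omega> h"
    and v: "weak_sol_D1 \<Omega> \<epsilon> L h v" and w: "weak_sol_D1 \<Omega> \<epsilon> L h w"
  shows "AE x in lebesgue. x \<in> \<Omega> \<longrightarrow> w x = v x"
proof -
  have le: "AE x in lebesgue. x \<in> \<Omega> \<longrightarrow> u x \<le> v x"
    if u: "weak_sol_D1 \<Omega> \<epsilon> L h u" and v: "weak_sol_D1 \<Omega> \<epsilon> L h v" for u v
  proof -
    let ?N = "D1_operator (\<epsilon> - lambda1 \<Omega>) L (\<lambda>x. indicator \<Omega> x * h x)"
    obtain g where g: "H10 \<Omega> u g" "\<And>s. s \<in> energy_space \<Omega> \<Longrightarrow> abs_l2 (?N (zero_ext \<Omega> u g)) \<bullet> s = 0"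
      using u unfolding weak_sol_D1_iff[OF assms(5)] by blast
    have N: "sq_integrable (?N (zero_ext \<Omega> u g))"
      using g(1) assms(5) by (intro sq_integrable_D1_operator) (auto simp: H10_iff_energy_space L2_iff_sq_integrable)
    show ?thesis
    proof (rule D1_comparison[OF assms(1-5) v g(1)])
      fix k assume "sq_integrable k" "abs_l2 k \<in> energy_space \<Omega>"
      then show "(LINT x|lebesgue. ?N (zero_ext \<Omega> u g) x \<bullet> k x) \<le> 0"
        using g(2)[of "abs_l2 k"] N by (simp add: inner_l2.abs_eq)
    qed
  qed
  show ?thesis using le[OF v w] le[OF w v] by eventually_elim auto
qed

lemma D1_solution_nonneg:
  assumes "open \<Omega>" "0 < \<epsilon>" "0 \<le> L" "L < Lmax \<epsilon> (lambda1 \<Omega>)" "L2 \<Omega> h"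
    and h: "AE x in lebesgue. x \<in> \<Omega> \<longrightarrow> 0 \<le> h x" and v: "weak_sol_D1 \<Omega> \<epsilon> L h v"
  shows "AE x in lebesgue. x \<in> \<Omega> \<longrightarrow> 0 \<le> v x"
proof (rule D1_comparison[OF assms(1-5) v H10_zero])
  fix k :: "'a \<Rightarrow> real \<times> 'a"
  assume k: "sq_integrable k" "\<And>x. 0 \<le> fst (k x)"
  have "(LINT x|lebesgue. D1_operator (\<epsilon> - lambda1 \<Omega>) L (\<lambda>x. indicator \<Omega> x * h x) (zero_ext \<Omega> (\<lambda>x. 0) (\<lambda>x. 0)) x \<bullet> k x)
     = (LINT x|lebesgue. - (indicator \<Omega> x * h x * fst (k x)))"
    by (simp add: D1_operator_def zero_ext_def inner_prod_def)
  also have "\<dots> = - (LINT x|lebesgue. indicator \<Omega> x * h x * fst (k x))" by simp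
  also have "\<dots> \<le> 0"
    using h k(2) by (auto intro!: integral_nonneg_AE simp: indicator_def)
  finally show "(LINT x|lebesgue. D1_operator (\<epsilon> - lambda1 \<Omega>) L (\<lambda>x. indicator \<Omega> x * h x)
      (zero_ext \<Omega> (\<lambda>x. 0) (\<lambda>x. 0)) x \<bullet> k x) \<le> 0" .
qed

text \<open>A bound on B where u > 0 is enough: the tests are positive only where v < u, and v >= 0.
  The formulation with B covers both u and -u, and so yields both estimates for problem (P).\<close>

lemma bounded_rhs_comparison:
  fixes \<Omega> :: "'a::euclidean_space set"
  assumes "open \<Omega>" "0 < \<epsilon>" "0 \<le> L" "L < Lmax \<epsilon> (lambda1 \<Omega>)" "L2 \<Omega> h"
    and h: "AE x in lebesgue. x \<in> \<Omega> \<longrightarrow> 0 \<le> h x" and v: "weak_sol_D1 \<Omega> \<epsilon> L h v"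
    and u: "H10 \<Omega> u g" and B: "sq_integrable B"
    and weak: "\<And>\<phi>. test_fun \<Omega> \<phi> \<Longrightarrow>
      (LINT x:\<Omega>|lebesgue. g x \<bullet> grad \<phi> x) + \<mu> * (LINT x:\<Omega>|lebesgue. u x * \<phi> x) = (LINT x|lebesgue. B x * \<phi> x)"
    and bound: "AE x in lebesgue. x \<in> \<Omega> \<longrightarrow> 0 < u x \<longrightarrow>
      B x \<le> (\<mu> - (\<epsilon> - lambda1 \<Omega>)) * u x + L * norm (g x) + h x"
  shows "AE x in lebesgue. x \<in> \<Omega> \<longrightarrow> u x \<le> v x"
proof (rule D1_comparison[OF assms(1-5) v u])
  let ?N = "D1_operator (\<epsilon> - lambda1 \<Omega>) L (\<lambda>x. indicator \<Omega> x * h x)"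
  define f where "f = zero_ext \<Omega> u g"
  have f: "sq_integrable f" using u by (simp add: f_def H10_iff_energy_space)
  have N: "sq_integrable (?N f)"
    using f assms(5) by (intro sq_integrable_D1_operator) (auto simp: L2_iff_sq_integrable)
  \<comment> \<open>Moving \<mu> u to the right leaves -\<Delta> u = r. In the sum of r and the
    first component of the operator \<mu> u cancels, and the assumed bound on B says precisely that
    this sum is <= 0 where u > 0.\<close>
  define r where "r x = B x - \<mu> * fst (f x)" for x
  have fs: "sq_integrable (\<lambda>x. fst (f x))" by (rule sq_integrable_fst[OF f])
  have r: "sq_integrable r"
    unfolding r_def[abs_def] using sq_integrable_diff[OF B sq_integrable_scaleR[OF fs, of \<mu>]] by simp
  have weak': "(LINT x|lebesgue. snd (f x) \<bullet> grad \<phi> x) = (LINT x|lebesgue. r x * \<phi> x)" if "test_fun \<Omega> \<phi>" for \<phi>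
  proof -
    have \<phi>: "sq_integrable \<phi>" using sq_integrable_fst[OF sq_integrable_jet[OF that]] by (simp add: jet_def)
    have "(LINT x|lebesgue. r x * \<phi> x) = (LINT x|lebesgue. B x * \<phi> x) - \<mu> * (LINT x|lebesgue. fst (f x) * \<phi> x)"
      using integrable_inner_sq_integrable[OF B \<phi>] integrable_inner_sq_integrable[OF fs \<phi>]
      by (simp add: r_def left_diff_distrib mult.assoc)
    moreover have "(LINT x|lebesgue. fst (f x) * \<phi> x) = (LINT x:\<Omega>|lebesgue. u x * \<phi> x)"
      "(LINT x|lebesgue. snd (f x) \<bullet> grad \<phi> x) = (LINT x:\<Omega>|lebesgue. g x \<bullet> grad \<phi> x)"
      by (simp_all add: set_lebesgue_integral_def f_def zero_ext_def mult.assoc)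
    ultimately show ?thesis using weak[OF that] by simp
  qed
  fix k :: "'a \<Rightarrow> real \<times> 'a"
  assume k: "sq_integrable k" "abs_l2 k \<in> energy_space \<Omega>" "\<And>x. 0 \<le> fst (k x)"
    and k_pos: "\<And>x. 0 < fst (k x) \<Longrightarrow> x \<in> \<Omega> \<and> v x < u x"
  note ks = sq_integrable_fst[OF k(1)]
  have i1: "integrable lebesgue (\<lambda>x. fst (?N f x) * fst (k x))"
    using integrable_inner_sq_integrable[OF sq_integrable_fst[OF N] ks] by simp
  have i2: "integrable lebesgue (\<lambda>x. snd (f x) \<bullet> snd (k x))"
    by (intro integrable_inner_sq_integrable sq_integrable_snd f k(1))
  have i3: "integrable lebesgue (\<lambda>x. r x * fst (k x))"
    using integrable_inner_sq_integrable[OF r ks] by simp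
  have "(LINT x|lebesgue. ?N f x \<bullet> k x) = (LINT x|lebesgue. fst (?N f x) * fst (k x) + snd (f x) \<bullet> snd (k x))"
    by (simp add: inner_prod_def D1_operator_def)
  also have "\<dots> = (LINT x|lebesgue. fst (?N f x) * fst (k x)) + (LINT x|lebesgue. r x * fst (k x))"
    using i1 i2 weak_form_energy_space[OF r sq_integrable_snd[OF f] weak' k(1,2)] by simp
  also have "\<dots> = - (LINT x|lebesgue. - ((fst (?N f x) + r x) * fst (k x)))"
    using i1 i3 by (simp add: distrib_right)
  also have "\<dots> \<le> 0"
  proof -
    have "AE x in lebesgue. 0 \<le> - ((fst (?N f x) + r x) * fst (k x))"
      using bound D1_solution_nonneg[OF assms(1-5) h v]
    proof eventually_elim
      case (elim x)
      show ?case
      proof (cases "fst (k x) = 0")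
        case False
        then have "0 < fst (k x)" using k(3)[of x] by simp
        moreover from k_pos[OF this] have "x \<in> \<Omega>" "0 < u x" using elim(2) by auto
        then have "fst (?N f x) + r x \<le> 0"
          using elim(1) by (simp add: D1_operator_def r_def f_def zero_ext_def algebra_simps)
        ultimately show ?thesis by (simp add: mult_le_0_iff)
      qed simp
    qed
    then show ?thesis by (simp only: neg_le_0_iff_le) (rule integral_nonneg_AE)
  qed
  finally show "(LINT x|lebesgue. ?N (zero_ext \<Omega> u g) x \<bullet> k x) \<le> 0" by (simp add: f_def)
qed

text \<open>Dividing (C) by s gives an upper bound for s > 0 and a lower bound for s < 0. The value
  s = 0 is included because the truncation can return 0 at points where u is nonzero, namely where
  v1 or v0 vanishes.\<close>

lemma coercive_bounds:
  assumes C: "coercive \<Omega> \<epsilon> L h f" and x: "x \<in> \<Omega>" and cont: "continuous_on UNIV (\<lambda>(s, \<xi>). f x s \<xi>)"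
  shows "0 \<le> s \<Longrightarrow> f x s \<xi> \<le> (lambda1 \<Omega> - \<epsilon>) * s + L * norm \<xi> + h x"
    and "s \<le> 0 \<Longrightarrow> (lambda1 \<Omega> - \<epsilon>) * s - L * norm \<xi> - h x \<le> f x s \<xi>"
proof -
  have base: "f x s \<xi> * s \<le> (lambda1 \<Omega> - \<epsilon>) * s\<^sup>2 + L * norm \<xi> * \<bar>s\<bar> + h x * \<bar>s\<bar>" for s
    using C x by (simp add: coercive_def)
  have pos: "f x s \<xi> \<le> (lambda1 \<Omega> - \<epsilon>) * s + L * norm \<xi> + h x" if "0 < s" for s
  proof -
    have "f x s \<xi> * s \<le> ((lambda1 \<Omega> - \<epsilon>) * s + L * norm \<xi> + h x) * s"
      using base[of s] that by (simp add: algebra_simps power2_eq_square)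
    then show ?thesis using that by simp
  qed
  have neg: "(lambda1 \<Omega> - \<epsilon>) * s - L * norm \<xi> - h x \<le> f x s \<xi>" if "s < 0" for s
  proof -
    have "f x s \<xi> * s \<le> ((lambda1 \<Omega> - \<epsilon>) * s - L * norm \<xi> - h x) * s"
      using base[of s] that by (simp add: algebra_simps power2_eq_square)
    then show ?thesis using that by simp
  qed
  \<comment> \<open>At \<open>s = 0\<close> condition (C) is void; the bounds come from \<open>s \<rightarrow> 0\<close> by continuity.\<close>
  define e :: "nat \<Rightarrow> real" where "e n = inverse (Suc n)" for n
  have e: "e \<longlonglongrightarrow> 0" "\<And>n. 0 < e n"
    using LIMSEQ_inverse_real_of_nat by (auto simp: e_def[abs_def])
  have lim: "(\<lambda>n. f x (y n) \<xi>) \<longlonglongrightarrow> f x 0 \<xi>" if "y \<longlonglongrightarrow> 0" for y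
    using continuous_on_tendsto_compose[OF cont tendsto_Pair[OF that tendsto_const[of \<xi>]]] by simp
  show "f x s \<xi> \<le> (lambda1 \<Omega> - \<epsilon>) * s + L * norm \<xi> + h x" if "0 \<le> s"
  proof (cases "s = 0")
    case True
    have "f x 0 \<xi> \<le> (lambda1 \<Omega> - \<epsilon>) * 0 + L * norm \<xi> + h x"
      by (rule LIMSEQ_le[OF lim[OF e(1)]
          tendsto_add[OF tendsto_add[OF tendsto_mult[OF tendsto_const e(1)] tendsto_const] tendsto_const]])
        (use pos e(2) in auto)
    then show ?thesis using True by simp
  qed (use that pos in auto)
  show "(lambda1 \<Omega> - \<epsilon>) * s - L * norm \<xi> - h x \<le> f x s \<xi>" if "s \<le> 0"
  proof (cases "s = 0")
    case True
    have me: "(\<lambda>n. - e n) \<longlonglongrightarrow> 0" using tendsto_minus[OF e(1)] by simp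
    have "(lambda1 \<Omega> - \<epsilon>) * 0 - L * norm \<xi> - h x \<le> f x 0 \<xi>"
      by (rule LIMSEQ_le[OF tendsto_diff[OF tendsto_diff[OF tendsto_mult[OF tendsto_const me] tendsto_const] tendsto_const]
          lim[OF me]])
        (use neg[of "- e _"] e(2) in auto)
    then show ?thesis using True by simp
  qed (use that neg in auto)
qed

text \<open>Truncation moves u towards 0 without reversing its sign. Since \<mu> >= \<epsilon> -
  \<open>lambda1 \<Omega>\<close>, the factor in front of s is nonnegative, so the bound at the
  truncated value implies the one at u. The lower estimate is the upper one for -u.\<close>

lemma weak_sol_P_between:
  fixes \<Omega> :: "'a::euclidean_space set"
  assumes "open \<Omega>" "0 < \<epsilon>" "0 \<le> L" "L < Lmax \<epsilon> (lambda1 \<Omega>)" "L2 \<Omega> h"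
    and h: "AE x in lebesgue. x \<in> \<Omega> \<longrightarrow> 0 \<le> h x" and v: "weak_sol_D1 \<Omega> \<epsilon> L h v"
    and f: "caratheodory \<Omega> f" "coercive \<Omega> \<epsilon> L h f"
    and \<mu>: "\<epsilon> - lambda1 \<Omega> \<le> \<mu>" and t: "0 < t" "t \<le> 1" and \<omega>: "\<omega> \<subseteq> \<Omega>"
    and v01: "\<forall>x\<in>\<Omega>. v0 x \<le> 0 \<and> 0 \<le> v1 x"
    and sol: "weak_sol_P \<Omega> f \<mu> t \<omega> v0 v1 u"
  shows "AE x in lebesgue. x \<in> \<Omega> \<longrightarrow> - v x \<le> u x \<and> u x \<le> v x"
proof -
  let ?a = "\<epsilon> - lambda1 \<Omega>"
  obtain g where g: "H10 \<Omega> u g" and bL2: "L2 \<Omega> (\<lambda>x. b_sigma f \<mu> v0 v1 x (u x) (g x) * indicator \<omega> x)"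
    and weak: "\<And>\<phi>. test_fun \<Omega> \<phi> \<Longrightarrow>
        (LINT x:\<Omega>|lebesgue. g x \<bullet> grad \<phi> x) + \<mu> * (LINT x:\<Omega>|lebesgue. u x * \<phi> x) =
        t * (LINT x:\<omega>|lebesgue. b_sigma f \<mu> v0 v1 x (u x) (g x) * \<phi> x)"
    using sol unfolding weak_sol_P_def by blast
  define b where "b x = b_sigma f \<mu> v0 v1 x (u x) (g x)" for x
  define B where "B x = t * (indicator \<Omega> x * (b x * indicator \<omega> x))" for x
  have B: "sq_integrable B"
    using bL2 sq_integrable_scaleR[of "\<lambda>x. indicator \<Omega> x * (b x * indicator \<omega> x)" t]
    by (simp add: L2_iff_sq_integrable B_def[abs_def] b_def)
  have weakB: "(LINT x:\<Omega>|lebesgue. g x \<bullet> grad \<phi> x) + \<mu> * (LINT x:\<Omega>|lebesgue. u x * \<phi> x) = (LINT x|lebesgue. B x * \<phi> x)"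
    if "test_fun \<Omega> \<phi>" for \<phi>
  proof -
    have "B x * \<phi> x = t * (indicator \<omega> x *\<^sub>R (b x * \<phi> x))" for x
      using \<omega> by (auto simp: B_def indicator_def)
    then have "(LINT x|lebesgue. B x * \<phi> x) = t * (LINT x:\<omega>|lebesgue. b x * \<phi> x)"
      by (simp only: set_lebesgue_integral_def integral_mult_right_zero)
    then show ?thesis using weak[OF that] by (simp add: b_def)
  qed
  have cont: "AE x in lebesgue. x \<in> \<Omega> \<longrightarrow> continuous_on UNIV (\<lambda>(s, \<xi>). f x s \<xi>)"
    using f(1) by (simp add: caratheodory_def)
  \<comment> \<open>Multiplying by t, and likewise by the indicator of \<omega>, moves a value
    towards 0, so an upper bound survives as long as it is nonnegative.\<close>
  have scale: "t * b' \<le> R" if "b' \<le> R" "0 \<le> R" for b' R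
  proof -
    have "t * b' \<le> t * R" using that(1) t(1) by simp
    also have "\<dots> \<le> R" using that(2) t(2) by (simp add: mult_left_le_one_le t(1) less_imp_le)
    finally show ?thesis .
  qed
  have up: "AE x in lebesgue. x \<in> \<Omega> \<longrightarrow> 0 < u x \<longrightarrow> B x \<le> (\<mu> - ?a) * u x + L * norm (g x) + h x"
    using cont h
  proof eventually_elim
    case (elim x)
    show ?case
    proof (intro impI)
      assume x: "x \<in> \<Omega>" and ux: "0 < u x"
      let ?R = "(\<mu> - ?a) * u x + L * norm (g x) + h x"
      define s where "s = sigma_trunc v0 v1 x (u x)"
      have s: "0 \<le> s" "s \<le> u x" using v01 x ux by (auto simp: s_def sigma_trunc_def)
      have R: "0 \<le> ?R" using \<mu> ux assms(3) elim x by simp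
      have "b x \<le> (\<mu> - ?a) * s + L * norm (g x) + h x"
        using coercive_bounds(1)[OF f(2) x, of s "g x"] elim x s(1) by (simp add: b_def b_sigma_def s_def algebra_simps)
      also have "\<dots> \<le> ?R" using mult_left_mono[OF s(2), of "\<mu> - ?a"] \<mu> by simp
      finally have "b x * indicator \<omega> x \<le> ?R" using R by (simp add: indicator_def)
      then show "B x \<le> ?R" using scale R x by (simp add: B_def)
    qed
  qed
  have low: "AE x in lebesgue. x \<in> \<Omega> \<longrightarrow> 0 < - u x \<longrightarrow> - B x \<le> (\<mu> - ?a) * (- u x) + L * norm (- g x) + h x"
    using cont h
  proof eventually_elim
    case (elim x)
    show ?case
    proof (intro impI)
      assume x: "x \<in> \<Omega>" and ux: "0 < - u x"
      let ?R = "(\<mu> - ?a) * (- u x) + L * norm (- g x) + h x"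
      define s where "s = sigma_trunc v0 v1 x (u x)"
      have s: "s \<le> 0" "- s \<le> - u x" using v01 x ux by (auto simp: s_def sigma_trunc_def)
      have R: "0 \<le> ?R" using \<mu> ux assms(3) elim x by (intro add_nonneg_nonneg mult_nonneg_nonneg) auto
      have "- b x \<le> (\<mu> - ?a) * (- s) + L * norm (- g x) + h x"
        using coercive_bounds(2)[OF f(2) x, of s "g x"] elim x s(1) by (simp add: b_def b_sigma_def s_def algebra_simps)
      also have "\<dots> \<le> ?R" using mult_left_mono[OF s(2), of "\<mu> - ?a"] \<mu> by simp
      finally have "- (b x * indicator \<omega> x) \<le> ?R" using R by (simp add: indicator_def)
      from scale[OF this R] show "- B x \<le> ?R" using x by (simp add: B_def)
    qed
  qed
  have weak_neg: "(LINT x:\<Omega>|lebesgue. (- g x) \<bullet> grad \<phi> x) + \<mu> * (LINT x:\<Omega>|lebesgue. (- u x) * \<phi> x) = (LINT x|lebesgue. (- B x) * \<phi> x)"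
    if "test_fun \<Omega> \<phi>" for \<phi>
    using weakB[OF that] by (simp add: set_lebesgue_integral_def)
  have "AE x in lebesgue. x \<in> \<Omega> \<longrightarrow> u x \<le> v x"
    by (rule bounded_rhs_comparison[OF assms(1-5) h v g B weakB up])
  moreover have "AE x in lebesgue. x \<in> \<Omega> \<longrightarrow> - u x \<le> v x"
    by (rule bounded_rhs_comparison[OF assms(1-5) h v H10_uminus[OF g] sq_integrable_uminus[OF B] weak_neg low])
  ultimately show ?thesis by eventually_elim auto
qed

theorem theorem2p3:
  fixes \<Omega> :: "'a::euclidean_space set"
    and \<epsilon> q L :: real and h :: "'a \<Rightarrow> real"
  assumes "open \<Omega>"
    and "\<epsilon> > 0" and "q \<ge> 2" and "q \<noteq> real DIM('a) / 2"
    and "AE x in lebesgue. x \<in> \<Omega> \<longrightarrow> 0 \<le> h x"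
    and "L2 \<Omega> h" and "Lq q \<Omega> h"
    and "0 \<le> L" and "L < Lmax \<epsilon> (lambda1 \<Omega>)"
  shows "\<exists>vd vu.
     weak_sol_D0 \<Omega> \<epsilon> L h vd \<and>
     (\<forall>w. weak_sol_D0 \<Omega> \<epsilon> L h w \<longrightarrow> (AE x in lebesgue. x \<in> \<Omega> \<longrightarrow> w x = vd x)) \<and>
     weak_sol_D1 \<Omega> \<epsilon> L h vu \<and>
     (\<forall>w. weak_sol_D1 \<Omega> \<epsilon> L h w \<longrightarrow> (AE x in lebesgue. x \<in> \<Omega> \<longrightarrow> w x = vu x)) \<and>
     (AE x in lebesgue. x \<in> \<Omega> \<longrightarrow> vd x \<le> 0 \<and> 0 \<le> vu x) \<and>
     (\<forall>f \<mu> t \<omega> v0 v1 u.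
        caratheodory \<Omega> f \<longrightarrow> coercive \<Omega> \<epsilon> L h f \<longrightarrow>
        \<mu> \<ge> max 0 (\<epsilon> - lambda1 \<Omega>) \<longrightarrow> 0 < t \<longrightarrow> t \<le> 1 \<longrightarrow>
        open \<omega> \<longrightarrow> \<omega> \<subseteq> \<Omega> \<longrightarrow>
        set_borel_measurable lebesgue \<Omega> v0 \<longrightarrow> set_borel_measurable lebesgue \<Omega> v1 \<longrightarrow>
        (\<forall>x\<in>\<Omega>. v0 x \<le> 0 \<and> 0 \<le> v1 x) \<longrightarrow>
        weak_sol_P \<Omega> f \<mu> t \<omega> v0 v1 u \<longrightarrow>
        (AE x in lebesgue. x \<in> \<Omega> \<longrightarrow> vd x \<le> u x \<and> u x \<le> vu x))"
proof -
  note hyps = assms(1,2,8,9,6)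
  obtain v where v: "weak_sol_D1 \<Omega> \<epsilon> L h v" using D1_solution_exists[OF hyps] by blast
  have uniq: "AE x in lebesgue. x \<in> \<Omega> \<longrightarrow> w x = v x" if "weak_sol_D1 \<Omega> \<epsilon> L h w" for w
    by (rule D1_solution_unique[OF hyps v that])
  show ?thesis
  proof (rule exI[of _ "\<lambda>x. - v x"], rule exI[of _ v], intro conjI allI impI)
    show "weak_sol_D0 \<Omega> \<epsilon> L h (\<lambda>x. - v x)" using v by (simp add: weak_sol_D0_iff_D1)
    show "AE x in lebesgue. x \<in> \<Omega> \<longrightarrow> w x = - v x" if "weak_sol_D0 \<Omega> \<epsilon> L h w" for w
      using uniq[OF that[unfolded weak_sol_D0_iff_D1]] by eventually_elim auto
    show "AE x in lebesgue. x \<in> \<Omega> \<longrightarrow> - v x \<le> 0 \<and> 0 \<le> v x"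
      using D1_solution_nonneg[OF hyps assms(5) v] by eventually_elim auto
  next
    fix f \<mu> t \<omega> v0 v1 u
    assume "caratheodory \<Omega> f" "coercive \<Omega> \<epsilon> L h f" "max 0 (\<epsilon> - lambda1 \<Omega>) \<le> \<mu>"
      "0 < t" "t \<le> 1" "\<omega> \<subseteq> \<Omega>" "\<forall>x\<in>\<Omega>. v0 x \<le> 0 \<and> 0 \<le> v1 x" "weak_sol_P \<Omega> f \<mu> t \<omega> v0 v1 u"
    then show "AE x in lebesgue. x \<in> \<Omega> \<longrightarrow> - v x \<le> u x \<and> u x \<le> v x"
      by (intro weak_sol_P_between[OF hyps assms(5) v]) auto
  qed (use v uniq in auto)
qed

end
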